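(* Let $D\subseteq\mathbb{R}^d$ be open, $f:D\to\mathbb{R}^d$ locally Lipschitz, and $x^*\in D$ an equilibrium of $\dot x=f(x)$. Let $\varepsilon>0$ and let $S\subset D$ be compact with $B_\varepsilon(x^* )\subset\mathrm{int}(S)$. If $V(x)=\|x-x^*\|$ is an $\varepsilon$-Strict Recurrent Lyapunov Function ($\varepsilon$-SRLF) over $S$ with parameter $\tau>0$, then $x^*$ is practically asymptotically stable on $S$ with precision $$\varepsilon':=\varepsilon+F_\varepsilon\,h(\tau;L),$$ where $F_\varepsilon:=\sup_{x\in B_\varepsilon(x^* )}\|f(x)\|$, $L:=L_{\mathrm{cl}\,\mathcal{R}^\tau(B_\varepsilon(x^* ))}$ is the one-sided Lipschitz constant of $f$ over $\mathrm{cl}\,\mathcal{R}^\tau(B_\varepsilon(x^* ))$, and $h(\tau;L)=(e^{L\tau}-1)/L$ if $L\neq0$, $h(\tau;0)=\tau$.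
   Context: $\|\cdot\|$ is a fixed norm on $\mathbb{R}^d$ and $B_r(x)$ is the closed ball of radius $r$ around $x$. Locally Lipschitz means: for every compact $K\subset D$ there is $\overline L_K\ge 0$ with $\|f(y)-f(x)\|\le \overline L_K\|y-x\|$ for all $x,y\in K$. For $x\in D$, $\phi(t,x)$ is the solution of $\dot x=f(x)$ with $\phi(0,x)=x$, on its maximal open interval of existence $I(x)\ni 0$. Assertions about $\phi(t,x)$ for all $t\ge0$ (or $t\to\infty$) include existence of the solution for all $t\ge0$. Weak pairing: the norm is equipped with an associated weak pairing $[\cdot;\cdot]:\mathbb{R}^d\times\mathbb{R}^d\to\mathbb{R}$, i.e. a map with (i) $[x_1+x_2;y]\le[x_1;y]+[x_2;y]$; (ii) $[\alpha x;y]=[x;\alpha y]=\alpha[x;y]$ for $\alpha>0$ and $[-x;-y]=[x;y]$; (iii) $[x;x]>0$ for $x\ne0$; (iv) $|[x;y]|\le[x;x]^{1/2}[y;y]^{1/2}$; such that $\|x\|=[x;x]^{1/2}$, and satisfying the curve norm derivative formula $\|x(t)\|\,D^+\|x(t)\|=[\dot x(t);x(t)]$ along differentiable curves, where $D^+\varphi(t)=\limsup_{h\to0^+}(\varphi(t+h)-\varphi(t))/h$. The one-sided Lipschitz constant of $f$ over a compact $K\subset D$ is the smallest $L_K\in\mathbb{R}$ with $[f(y)-f(x);y-x]\le L_K\|y-x\|^2$ for all $x,y\in K$. Reachable tube: $\mathcal{R}^\tau(A)=\{\phi(t,x): x\in A,\ t\in[0,\tau]\cap I(x)\}$. Containment times: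 $T_S(x;\tau):=\{t\in(0,\tau]: \phi(t,x)\in S\}$ (with $t\in I(x)$). An inequality $\min_{s\in T_S(x;\tau)}g(s)<c$ means that there is $s\in T_S(x;\tau)$ with $g(s)<c$. $\varepsilon$-SRLF: a continuous $V:D\to\mathbb{R}_{\ge0}$ is an $\varepsilon$-SRLF over $S$ with parameter $\tau$ if (i) $V(x^* )=0$ and $V(x)>0$ for all $x\in D\setminus\{x^*\}$; (ii) $\min_{s\in T_S(x;\tau)}V(\phi(s,x))<V(x)$ for all $x\in K_\varepsilon:=\mathrm{cl}(S\setminus B_\varepsilon(x^* ))$. Practically asymptotically stable on $S$ with precision $\varepsilon'>0$: (i) there is $\delta>0$ such that $\|x-x^*\|\le\delta$ implies $\|\phi(t,x)-x^*\|\le\varepsilon'$ for all $t\ge0$; and (ii) $\limsup_{t\to\infty}\|\phi(t,x)-x^*\|\le\varepsilon'$ for all $x\in S$. *)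

theory Defs
  imports "HOL-Analysis.Analysis"
begin

text \<open>
  The norm on \<open>\<real>\<^sup>d\<close> is an arbitrary function \<open>N\<close>, unrelated to the Euclidean \<^const>\<open>norm\<close> of the
  type. Topological notions and derivatives are those of the type; they do not depend on the
  choice of norm in finite dimension.
\<close>

definition vector_norm :: "(real ^ 'd \<Rightarrow> real) \<Rightarrow> bool" where
  "vector_norm N \<longleftrightarrow>
     (\<forall>x. 0 \<le> N x) \<and>
     (\<forall>x. N x = 0 \<longleftrightarrow> x = 0) \<and>
     (\<forall>c x. N (c *\<^sub>R x) = \<bar>c\<bar> * N x) \<and>
     (\<forall>x y. N (x + y) \<le> N x + N y)"

definition norm_ball :: "(real ^ 'd \<Rightarrow> real) \<Rightarrow> real ^ 'd \<Rightarrow> real \<Rightarrow> (real ^ 'd) set" where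
  "norm_ball N x r = {y. N (y - x) \<le> r}"

definition upper_right_dini :: "(real \<Rightarrow> real) \<Rightarrow> real \<Rightarrow> ereal" where
  "upper_right_dini g t = Limsup (at_right 0) (\<lambda>h. ereal ((g (t + h) - g t) / h))"

definition weak_pairing :: "(real ^ 'd \<Rightarrow> real ^ 'd \<Rightarrow> real) \<Rightarrow> bool" where
  "weak_pairing P \<longleftrightarrow>
     (\<forall>x\<^sub>1 x\<^sub>2 y. P (x\<^sub>1 + x\<^sub>2) y \<le> P x\<^sub>1 y + P x\<^sub>2 y) \<and>
     (\<forall>\<alpha> x y. \<alpha> > 0 \<longrightarrow> P (\<alpha> *\<^sub>R x) y = \<alpha> * P x y \<and> P x (\<alpha> *\<^sub>R y) = \<alpha> * P x y) \<and>
     (\<forall>x y. P (- x) (- y) = P x y) \<and>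
     (\<forall>x. x \<noteq> 0 \<longrightarrow> P x x > 0) \<and>
     (\<forall>x y. \<bar>P x y\<bar> \<le> sqrt (P x x) * sqrt (P y y))"

definition curve_norm_derivative_formula ::
  "(real ^ 'd \<Rightarrow> real) \<Rightarrow> (real ^ 'd \<Rightarrow> real ^ 'd \<Rightarrow> real) \<Rightarrow> bool" where
  "curve_norm_derivative_formula N P \<longleftrightarrow>
     (\<forall>c c' a b.
        (\<forall>t\<in>{a<..<b}. (c has_vector_derivative c' t) (at t)) \<longrightarrow>
        (\<forall>t\<in>{a<..<b}. ereal (N (c t)) * upper_right_dini (\<lambda>s. N (c s)) t = ereal (P (c' t) (c t))))"

definition associated_weak_pairing ::
  "(real ^ 'd \<Rightarrow> real) \<Rightarrow> (real ^ 'd \<Rightarrow> real ^ 'd \<Rightarrow> real) \<Rightarrow> bool" where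
  "associated_weak_pairing N P \<longleftrightarrow>
     weak_pairing P \<and> (\<forall>x. N x = sqrt (P x x)) \<and> curve_norm_derivative_formula N P"

definition locally_lipschitz ::
  "(real ^ 'd \<Rightarrow> real) \<Rightarrow> (real ^ 'd) set \<Rightarrow> (real ^ 'd \<Rightarrow> real ^ 'd) \<Rightarrow> bool" where
  "locally_lipschitz N D f \<longleftrightarrow>
     (\<forall>K. compact K \<and> K \<subseteq> D \<longrightarrow>
        (\<exists>L\<ge>0. \<forall>x\<in>K. \<forall>y\<in>K. N (f y - f x) \<le> L * N (y - x)))"

definition one_sided_lipschitz_constant ::
  "(real ^ 'd \<Rightarrow> real) \<Rightarrow> (real ^ 'd \<Rightarrow> real ^ 'd \<Rightarrow> real) \<Rightarrow> (real ^ 'd \<Rightarrow> real ^ 'd) \<Rightarrow>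
   (real ^ 'd) set \<Rightarrow> real" where
  "one_sided_lipschitz_constant N P f K =
     (LEAST L. \<forall>x\<in>K. \<forall>y\<in>K. P (f y - f x) (y - x) \<le> L * (N (y - x))\<^sup>2)"

definition ivp_solution ::
  "(real ^ 'd) set \<Rightarrow> (real ^ 'd \<Rightarrow> real ^ 'd) \<Rightarrow> real ^ 'd \<Rightarrow> real set \<Rightarrow> (real \<Rightarrow> real ^ 'd) \<Rightarrow> bool"
  where
  "ivp_solution D f x J u \<longleftrightarrow>
     open J \<and> is_interval J \<and> 0 \<in> J \<and> u 0 = x \<and>
     (\<forall>t\<in>J. u t \<in> D \<and> (u has_vector_derivative f (u t)) (at t))"

definition existence_interval ::
  "(real ^ 'd) set \<Rightarrow> (real ^ 'd \<Rightarrow> real ^ 'd) \<Rightarrow> real ^ 'd \<Rightarrow> real set" where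
  "existence_interval D f x = \<Union>{J. \<exists>u. ivp_solution D f x J u}"

text \<open>
  For locally Lipschitz \<open>f\<close>, \<open>D\<close> open and \<open>x \<in> D\<close>, the maximal solution exists and is unique on
  the existence interval. The value of \<open>flow D f t x\<close> for \<open>t\<close> outside that interval is
  meaningless, so every use below is guarded.
\<close>

definition flow ::
  "(real ^ 'd) set \<Rightarrow> (real ^ 'd \<Rightarrow> real ^ 'd) \<Rightarrow> real \<Rightarrow> real ^ 'd \<Rightarrow> real ^ 'd" where
  "flow D f t x = (SOME u. ivp_solution D f x (existence_interval D f x) u) t"

definition reachable_tube ::
  "(real ^ 'd) set \<Rightarrow> (real ^ 'd \<Rightarrow> real ^ 'd) \<Rightarrow> real \<Rightarrow> (real ^ 'd) set \<Rightarrow> (real ^ 'd) set" where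
  "reachable_tube D f \<tau> A =
     {flow D f t x |t x. x \<in> A \<and> t \<in> {0..\<tau>} \<inter> existence_interval D f x}"

definition containment_times ::
  "(real ^ 'd) set \<Rightarrow> (real ^ 'd \<Rightarrow> real ^ 'd) \<Rightarrow> (real ^ 'd) set \<Rightarrow> real ^ 'd \<Rightarrow> real \<Rightarrow> real set" where
  "containment_times D f S x \<tau> =
     {t \<in> {0<..\<tau>} \<inter> existence_interval D f x. flow D f t x \<in> S}"

definition eps_SRLF ::
  "(real ^ 'd \<Rightarrow> real) \<Rightarrow> (real ^ 'd) set \<Rightarrow> (real ^ 'd \<Rightarrow> real ^ 'd) \<Rightarrow> real ^ 'd \<Rightarrow> real \<Rightarrow>
   (real ^ 'd) set \<Rightarrow> real \<Rightarrow> (real ^ 'd \<Rightarrow> real) \<Rightarrow> bool" where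
  "eps_SRLF N D f xs \<epsilon> S \<tau> V \<longleftrightarrow>
     continuous_on D V \<and> (\<forall>x\<in>D. 0 \<le> V x) \<and>
     V xs = 0 \<and> (\<forall>x\<in>D - {xs}. V x > 0) \<and>
     (\<forall>x\<in>closure (S - norm_ball N xs \<epsilon>).
        \<exists>s\<in>containment_times D f S x \<tau>. V (flow D f s x) < V x)"

definition practically_asymptotically_stable ::
  "(real ^ 'd \<Rightarrow> real) \<Rightarrow> (real ^ 'd) set \<Rightarrow> (real ^ 'd \<Rightarrow> real ^ 'd) \<Rightarrow> real ^ 'd \<Rightarrow>
   (real ^ 'd) set \<Rightarrow> real \<Rightarrow> bool" where
  "practically_asymptotically_stable N D f xs S \<epsilon>' \<longleftrightarrow>
     \<epsilon>' > 0 \<and>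
     (\<exists>\<delta>>0. \<forall>x. N (x - xs) \<le> \<delta> \<longrightarrow>
        {0..} \<subseteq> existence_interval D f x \<and> (\<forall>t\<ge>0. N (flow D f t x - xs) \<le> \<epsilon>')) \<and>
     (\<forall>x\<in>S. {0..} \<subseteq> existence_interval D f x \<and>
        Limsup at_top (\<lambda>t. ereal (N (flow D f t x - xs))) \<le> ereal \<epsilon>')"

definition growth_factor :: "real \<Rightarrow> real \<Rightarrow> real" where
  "growth_factor \<tau> L = (if L = 0 then \<tau> else (exp (L * \<tau>) - 1) / L)"

end

theory Submission
  imports Defs
begin

text \<open>
  Every point of \<open>S\<close> returns to \<open>S\<close>: near \<open>x\<^sup>*\<close> by continuity, elsewhere by the SRLF condition. A
  bounded set of visiting times would have a last element, so \<open>S\<close> is visited at arbitrarily late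
  times and all solutions starting in \<open>S\<close> are global. An orbit that starts in the ball
  \<open>B\<^sub>\<epsilon>(x\<^sup>*)\<close> and leaves it through a boundary point \<open>y\<close> is back within time \<open>\<tau>\<close>; meanwhile its distance
  from \<open>y\<close> satisfies \<open>D\<^sup>+ w \<le> L w + F\<^sub>\<epsilon>\<close> with \<open>w(0) = 0\<close>, hence \<open>w \<le> F\<^sub>\<epsilon> h(\<tau>; L)\<close>. Finally every orbit
  from \<open>S\<close> reaches the ball, since otherwise a point of minimal norm in the intersection of \<open>S\<close> with
  its \<open>\<omega>\<close>-limit set would contradict the SRLF condition.
\<close>

section \<open>The flow of a locally Lipschitz vector field\<close>

text \<open>The squared distance weighted by \<open>exp (- 2 * M * (t - a))\<close> has nonpositive
  derivative, by Cauchy-Schwarz and the Lipschitz bound. Squaring avoids differentiating the norm at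
  points where the two solutions meet.\<close>

lemma gronwall_lipschitz:
  fixes u v :: "real \<Rightarrow> 'a::real_inner"
  assumes lip: "M-lipschitz_on K f" and "a \<le> b"
    and u: "\<And>t. t \<in> {a..b} \<Longrightarrow> u t \<in> K \<and> (u has_vector_derivative f (u t)) (at t)"
    and v: "\<And>t. t \<in> {a..b} \<Longrightarrow> v t \<in> K \<and> (v has_vector_derivative f (v t)) (at t)"
  shows "norm (u b - v b) \<le> exp (M * (b - a)) * norm (u a - v a)"
proof -
  define g where "g t = exp (- 2 * M * (t - a)) * ((u t - v t) \<bullet> (u t - v t))" for t
  have "g b \<le> g a"
  proof (rule DERIV_nonpos_imp_nonincreasing[OF \<open>a \<le> b\<close>])
    fix t assume "a \<le> t" "t \<le> b"
    then have t: "t \<in> {a..b}" by simp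
    define w where "w = u t - v t"
    define w' where "w' = f (u t) - f (v t)"
    have "((\<lambda>t. u t - v t) has_vector_derivative w') (at t)"
      unfolding w'_def using u[OF t] v[OF t] by (auto intro: has_vector_derivative_diff)
    then have d: "((\<lambda>t. u t - v t) has_derivative (\<lambda>h. h *\<^sub>R w')) (at t)"
      by (simp add: has_vector_derivative_def)
    have d2: "((\<lambda>t. (u t - v t) \<bullet> (u t - v t)) has_real_derivative 2 * (w \<bullet> w')) (at t)"
      unfolding has_field_derivative_def w_def
      by (rule has_derivative_eq_rhs[OF has_derivative_inner[OF d d]])
        (auto simp: inner_commute fun_eq_iff)
    have "((\<lambda>t. exp (- 2 * M * (t - a))) has_real_derivative
        exp (- 2 * M * (t - a)) * (- 2 * M)) (at t)"
      by (auto intro!: derivative_eq_intros)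
    from DERIV_mult[OF this d2]
    have "(g has_real_derivative exp (- 2 * M * (t - a)) * (2 * (w \<bullet> w') - 2 * M * (w \<bullet> w))) (at t)"
      unfolding g_def[abs_def] w_def by (rule DERIV_cong) (simp add: algebra_simps)
    moreover have "w \<bullet> w' \<le> M * (w \<bullet> w)"
    proof -
      have "w \<bullet> w' \<le> norm w * norm w'" by (rule norm_cauchy_schwarz)
      also have "\<dots> \<le> norm w * (M * norm w)"
        using lipschitz_on_normD[OF lip, of "u t" "v t"] u[OF t] v[OF t]
        by (intro mult_left_mono) (auto simp: w_def w'_def)
      finally show ?thesis by (simp add: dot_square_norm power2_eq_square algebra_simps)
    qed
    ultimately show "\<exists>y. (g has_real_derivative y) (at t) \<and> y \<le> 0"
      by (force intro: mult_nonneg_nonpos)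
  qed
  then have "exp (- 2 * M * (b - a)) * (norm (u b - v b))\<^sup>2 \<le> (norm (u a - v a))\<^sup>2"
    by (simp add: g_def dot_square_norm)
  then have "exp (2 * M * (b - a)) * (exp (- 2 * M * (b - a)) * (norm (u b - v b))\<^sup>2)
      \<le> exp (2 * M * (b - a)) * (norm (u a - v a))\<^sup>2"
    by (intro mult_left_mono) auto
  then have "(norm (u b - v b))\<^sup>2 \<le> exp (2 * M * (b - a)) * (norm (u a - v a))\<^sup>2"
    by (simp add: mult.assoc[symmetric] exp_add[symmetric])
  also have "\<dots> = (exp (M * (b - a)) * norm (u a - v a))\<^sup>2"
    by (simp add: power_mult_distrib exp_double[symmetric] algebra_simps)
  finally show ?thesis
    by (rule power2_le_imp_le) auto
qed

text \<open>Banach's fixed point theorem for the integral operator on the bounded continuous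
  functions on the whole line. Boundedness of \<open>g\<close> confines the solution to a ball
  around \<open>x\<close>, which later lets a truncated vector field be replaced by the original
  one.\<close>

lemma picard_lindelof_bounded:
  fixes g :: "'a::banach \<Rightarrow> 'a"
  assumes lip: "L-lipschitz_on UNIV g" and bound: "\<And>x. norm (g x) \<le> M"
    and "0 < h" and contr: "4 * h * L < 1"
  obtains u where "u 0 = x" "\<And>t. norm (u t - x) \<le> 4 * h * M"
    "\<And>t. t \<in> {-h<..<h} \<Longrightarrow> (u has_vector_derivative g (u t)) (at t)"
proof -
  \<comment> \<open>Time is clamped to \<open>{-h..h}\<close>, which turns \<open>T u\<close> into a
    bounded function on all of the line, as the type of bounded continuous functions requires. On
    the interval itself \<open>c\<close> is the identity.\<close>
  define c where "c t = max (-h) (min h t)" for t :: real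
  have c: "c t \<in> {-h..h}" "continuous_on UNIV c" for t
    using \<open>0 < h\<close> by (auto simp: c_def[abs_def] intro!: continuous_intros)
  \<comment> \<open>Integrating from \<open>-h\<close> rather than from \<open>0\<close> avoids oriented integrals; this costs the factor 4.\<close>
  define I where "I u t = integral {-h..t} (\<lambda>s. g (apply_bcontfun u s))" for u t
  define T where "T u t = x + (I u (c t) - I u 0)" for u t
  have g_cont: "continuous_on X (\<lambda>s. g (apply_bcontfun u s))" for u X
    by (rule continuous_on_compose2[OF lipschitz_on_continuous_on[OF lip]]) auto
  have I_deriv: "(I u has_vector_derivative g (apply_bcontfun u t)) (at t within {-h..h})"
    if "t \<in> {-h..h}" for u t
    unfolding I_def[abs_def] by (rule integral_has_vector_derivative[OF g_cont that])
  have I_cont: "continuous_on {-h..h} (I u)" for u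
    using I_deriv by (rule continuous_on_vector_derivative)
  have M: "0 \<le> M" using bound[of x] norm_ge_zero order_trans by blast
  have L: "0 \<le> L" using lip by (rule lipschitz_on_nonneg)
  have I_bound: "norm (I u t) \<le> 2 * h * M" if "t \<in> {-h..h}" for u t
  proof -
    have "norm (I u t) \<le> M * (t - - h)"
      unfolding I_def using that bound g_cont by (intro integral_bound) auto
    also have "\<dots> \<le> M * (2 * h)" using that M by (intro mult_left_mono) auto
    finally show ?thesis by (simp add: algebra_simps)
  qed
  have T_bound: "norm (T u t - x) \<le> 4 * h * M" for u t
  proof -
    have "norm (T u t - x) \<le> norm (I u (c t)) + norm (I u 0)"
      unfolding T_def by (simp add: norm_triangle_ineq4)
    then show ?thesis using I_bound[OF c(1), of u t] I_bound[of 0 u] \<open>0 < h\<close> by simp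
  qed
  have T_mem: "T u \<in> bcontfun" for u
  proof (rule bcontfun_normI)
    show "continuous_on UNIV (T u)"
      unfolding T_def[abs_def]
      by (intro continuous_intros continuous_on_compose2[OF I_cont c(2)]) (use c(1) in auto)
    show "norm (T u t) \<le> norm x + 4 * h * M" for t
      using T_bound[of u t] norm_triangle_sub[of "T u t" x] by simp
  qed
  have I_dist: "norm (I u t - I v t) \<le> 2 * h * L * dist u v" if "t \<in> {-h..h}" for u v t
  proof -
    have "I u t - I v t = integral {-h..t} (\<lambda>s. g (apply_bcontfun u s) - g (apply_bcontfun v s))"
      unfolding I_def
      by (intro integral_diff[symmetric] integrable_continuous_real g_cont)
    also have "norm \<dots> \<le> (L * dist u v) * (t - - h)"
    proof (rule integral_bound)
      show "norm (g (apply_bcontfun u s) - g (apply_bcontfun v s)) \<le> L * dist u v" for s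
        using lipschitz_on_normD[OF lip, of "apply_bcontfun u s" "apply_bcontfun v s"]
          mult_left_mono[OF dist_bounded[of u s v] L]
        by (simp add: dist_norm)
    qed (use that in \<open>auto intro: continuous_on_diff g_cont\<close>)
    also have "\<dots> \<le> (L * dist u v) * (2 * h)"
      using that L by (intro mult_left_mono) auto
    finally show ?thesis by (simp add: algebra_simps)
  qed
  have "\<exists>!u. u \<in> UNIV \<and> Bcontfun (T u) = u"
  proof (rule Banach_fix)
    show "0 \<le> 4 * h * L" using \<open>0 < h\<close> L by simp
    show "dist (Bcontfun (T u)) (Bcontfun (T v)) \<le> 4 * h * L * dist u v" for u v
    proof (rule dist_bound)
      fix t
      have "norm (T u t - T v t) \<le> norm (I u (c t) - I v (c t)) + norm (I u 0 - I v 0)"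
        unfolding T_def using norm_triangle_ineq4[of "I u (c t) - I v (c t)" "I u 0 - I v 0"]
        by (simp add: algebra_simps)
      then have "norm (T u t - T v t) \<le> 4 * h * L * dist u v"
        using I_dist[OF c(1), of u t v] I_dist[of 0 u v] \<open>0 < h\<close> by simp
      then show "dist (apply_bcontfun (Bcontfun (T u)) t) (apply_bcontfun (Bcontfun (T v)) t)
          \<le> 4 * h * L * dist u v"
        by (simp add: Bcontfun_inverse T_mem dist_norm)
    qed
  qed (auto simp: contr complete_UNIV)
  then obtain u where "Bcontfun (T u) = u" by blast
  then have u: "apply_bcontfun u = T u" using Bcontfun_inverse[OF T_mem[of u]] by simp
  show thesis
  proof
    show "apply_bcontfun u 0 = x" unfolding u T_def using \<open>0 < h\<close> by (simp add: c_def)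
    show "norm (apply_bcontfun u t - x) \<le> 4 * h * M" for t unfolding u by (rule T_bound)
    fix t assume t: "t \<in> {-h<..<h}"
    have "(I u has_vector_derivative g (apply_bcontfun u t)) (at t within {-h<..<h})"
      using t by (intro has_vector_derivative_within_subset[OF I_deriv]) auto
    then have "(I u has_vector_derivative g (apply_bcontfun u t)) (at t)"
      using at_within_open[OF t] by simp
    from has_vector_derivative_add[OF has_vector_derivative_const
        has_vector_derivative_diff[OF this has_vector_derivative_const]]
    have "((\<lambda>t. x + (I u t - I u 0)) has_vector_derivative g (apply_bcontfun u t)) (at t)"
      by simp
    then show "(apply_bcontfun u has_vector_derivative g (apply_bcontfun u t)) (at t)"
      by (rule has_vector_derivative_transform_within_open[of _ _ _ "{-h<..<h}"])
        (use t in \<open>auto simp: u T_def c_def\<close>)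
  qed
qed

section \<open>Uniqueness, maximal solutions and uniform local existence\<close>

text \<open>Lipschitz continuity refers to the Euclidean norm here, so that inner products and the
  library notion apply; \<open>locally_lipschitz_compact\<close> below translates the hypothesis on
  \<open>N\<close> into this form.\<close>

locale lipschitz_ode =
  fixes D :: "(real ^ 'd) set" and f :: "real ^ 'd \<Rightarrow> real ^ 'd"
  assumes open_D: "open D"
    and lipschitz_compact: "\<And>K. compact K \<Longrightarrow> K \<subseteq> D \<Longrightarrow> \<exists>M. M-lipschitz_on K f"
begin

lemma ivp_solution_continuous_on:
  assumes "ivp_solution D f x J u" "X \<subseteq> J"
  shows "continuous_on X u"
  using assms unfolding ivp_solution_def
  by (meson continuous_at_imp_continuous_on has_vector_derivative_continuous subset_iff)

text \<open>Over the segment from \<open>a\<close> to \<open>b\<close> both solutions trace compact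
  subsets of \<open>D\<close>, so one Lipschitz constant serves for both and the Gronwall inequality
  keeps their distance at zero.\<close>

lemma ivp_solution_unique:
  assumes u: "ivp_solution D f x J u" and v: "ivp_solution D f y J' v"
    and "a \<in> J \<inter> J'" "b \<in> J \<inter> J'" "u a = v a"
  shows "u b = v b"
proof -
  define C where "C = closed_segment a b"
  have C: "C \<subseteq> J" "C \<subseteq> J'"
    using u v assms(3,4) unfolding C_def ivp_solution_def
    by (auto simp: is_interval_convex closed_segment_subset)
  have "continuous_on C u" "continuous_on C v"
    using u v C by (auto intro: ivp_solution_continuous_on)
  then have "compact (u ` C \<union> v ` C)"
    unfolding C_def by (intro compact_Un compact_continuous_image) auto
  moreover have "u ` C \<union> v ` C \<subseteq> D"
    using u v C unfolding ivp_solution_def by blast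
  ultimately obtain M where M: "M-lipschitz_on (u ` C \<union> v ` C) f"
    using lipschitz_compact by blast
  have du: "(u has_vector_derivative f (u t)) (at t)" and dv: "(v has_vector_derivative f (v t)) (at t)"
    if "t \<in> C" for t
    using u v C that unfolding ivp_solution_def by blast+
  have "norm (u b - v b) \<le> exp (M * \<bar>b - a\<bar>) * norm (u a - v a)"
  proof (cases "a \<le> b")
    case True
    then have "C = {a..b}" by (simp add: C_def closed_segment_eq_real_ivl)
    then show ?thesis using gronwall_lipschitz[OF M True, of u v] du dv True by auto
  next
    case False
    then have C_eq: "C = {b..a}" by (simp add: C_def closed_segment_eq_real_ivl)
    \<comment> \<open>For \<open>b < a\<close>, time is reversed: the reversed curves solve the
      equation for \<open>- f\<close>, which has the same Lipschitz constant.\<close>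
    have rev: "((\<lambda>s. w (- s)) has_vector_derivative - f (w (- s))) (at s)"
      if "(w has_vector_derivative f (w (- s))) (at (- s))" for w s
      using vector_diff_chain_at[OF has_vector_derivative_minus[OF has_vector_derivative_id] that]
      by (simp add: o_def)
    have "M-lipschitz_on (u ` C \<union> v ` C) (\<lambda>x. - f x)"
      using M by (simp add: lipschitz_on_def dist_minus)
    from gronwall_lipschitz[OF this, of "-a" "-b" "\<lambda>s. u (- s)" "\<lambda>s. v (- s)"]
    have "norm (u b - v b) \<le> exp (M * (a - b)) * norm (u a - v a)"
      using False du dv by (simp add: C_eq rev)
    then show ?thesis using False by simp
  qed
  then show ?thesis using \<open>u a = v a\<close> by simp
qed

lemma ivp_solution_shift:
  assumes u: "ivp_solution D f x J u" and "s \<in> J"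
  shows "ivp_solution D f (u s) {t. t + s \<in> J} (\<lambda>t. u (t + s))"
  unfolding ivp_solution_def
proof (intro conjI ballI)
  have J: "open J" "is_interval J" using u by (auto simp: ivp_solution_def)
  have "open ((\<lambda>t. t + s) -` J)" by (intro open_vimage J continuous_intros)
  then show "open {t. t + s \<in> J}" by (simp add: vimage_def)
  show "is_interval {t. t + s \<in> J}"
    using J(2) unfolding is_interval_1 by (smt (verit) mem_Collect_eq)
  fix t assume "t \<in> {t. t + s \<in> J}"
  then have in_D: "u (t + s) \<in> D"
    and deriv: "(u has_vector_derivative f (u (t + s))) (at (t + s))"
    using u by (auto simp: ivp_solution_def)
  show "u (t + s) \<in> D" by (rule in_D)
  show "((\<lambda>t. u (t + s)) has_vector_derivative f (u (t + s))) (at t)"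
    using vector_diff_chain_at[OF has_vector_derivative_add[OF has_vector_derivative_id
          has_vector_derivative_const] deriv]
    by (simp add: o_def)
qed (use assms in auto)

text \<open>All solutions agree at time 0, hence on overlaps of their intervals by uniqueness, so
  they glue to one solution on the union.\<close>

lemma maximal_ivp_solution_exists:
  assumes "existence_interval D f x \<noteq> {}"
  shows "\<exists>u. ivp_solution D f x (existence_interval D f x) u"
proof -
  let ?I = "existence_interval D f x"
  \<comment> \<open>\<open>R t\<close> selects some interval and solution covering \<open>t\<close>;
    by uniqueness the value \<open>w t\<close> does not depend on the selection.\<close>
  define R where "R t = (SOME p. ivp_solution D f x (fst p) (snd p) \<and> t \<in> fst p)" for t
  have R: "ivp_solution D f x (fst (R t)) (snd (R t)) \<and> t \<in> fst (R t)" if "t \<in> ?I" for t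
    unfolding R_def by (rule someI_ex) (use that in \<open>auto simp: existence_interval_def\<close>)
  define w where "w t = snd (R t) t" for t
  have w: "w t = u t" if "ivp_solution D f x J u" "t \<in> J" for J u t
  proof -
    have "t \<in> ?I" using that by (auto simp: existence_interval_def)
    from R[OF this] have Rt: "ivp_solution D f x (fst (R t)) (snd (R t))" "t \<in> fst (R t)" by auto
    show ?thesis
      unfolding w_def using ivp_solution_unique[OF Rt(1) that(1), of 0 t] Rt that
      by (auto simp: ivp_solution_def)
  qed
  have "ivp_solution D f x ?I w"
    unfolding ivp_solution_def
  proof (intro conjI ballI)
    show "open ?I"
      unfolding existence_interval_def by (rule open_Union) (auto simp: ivp_solution_def)
    show "is_interval ?I"
      unfolding existence_interval_def is_interval_connected_1
      by (rule connected_Union) (auto simp: ivp_solution_def is_interval_connected_1)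
    obtain J u where Ju: "ivp_solution D f x J u"
      using assms by (auto simp: existence_interval_def)
    then show "0 \<in> ?I" "w 0 = x"
      using w[OF Ju, of 0] by (auto simp: ivp_solution_def existence_interval_def)
    fix t assume "t \<in> ?I"
    then obtain J u where Ju: "ivp_solution D f x J u" "t \<in> J"
      by (auto simp: existence_interval_def)
    have "(u has_vector_derivative f (u t)) (at t)" "open J" "u t \<in> D"
      using Ju by (auto simp: ivp_solution_def)
    moreover from this have "(w has_vector_derivative f (u t)) (at t)"
      using Ju(2) w[OF Ju(1)]
      by (intro has_vector_derivative_transform_within_open[of u _ t J w]) simp_all
    ultimately show "w t \<in> D" "(w has_vector_derivative f (w t)) (at t)"
      by (simp_all add: w[OF Ju])
  qed
  then show ?thesis by blast
qed

text \<open>Thickening \<open>C\<close> by a small closed ball stays inside the open set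
  \<open>D\<close>, and the Minkowski sum of two compact sets is compact. The margin
  \<open>r\<close> gives room to trajectories that start in or near \<open>C\<close>.\<close>

lemma lipschitz_tube:
  assumes "compact C" "C \<subseteq> D"
  obtains r K L where "r > 0" "\<And>x z. x \<in> C \<Longrightarrow> dist z x \<le> r \<Longrightarrow> z \<in> K"
    "compact K" "K \<subseteq> D" "L-lipschitz_on K f"
proof -
  obtain r where r: "r > 0" "(\<Union>x\<in>C. cball x r) \<subseteq> D"
    using compact_subset_open_imp_cball_epsilon_subset[OF assms(1) open_D assms(2)] .
  define K where "K = {x + y |x y. x \<in> C \<and> y \<in> cball 0 r}"
  have K: "compact K"
    unfolding K_def by (rule compact_sums[OF assms(1) compact_cball])
  have "K \<subseteq> D"
  proof
    fix z assume "z \<in> K"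
    then obtain x y where "z = x + y" "x \<in> C" "norm y \<le> r" by (auto simp: K_def)
    then have "z \<in> cball x r" by (simp add: dist_norm)
    with \<open>x \<in> C\<close> r(2) show "z \<in> D" by blast
  qed
  moreover obtain L where "L-lipschitz_on K f" using lipschitz_compact[OF K \<open>K \<subseteq> D\<close>] by blast
  moreover have "z \<in> K" if "x \<in> C" "dist z x \<le> r" for x z
  proof -
    have "z = x + (z - x)" "z - x \<in> cball 0 r"
      using that by (auto simp: dist_norm norm_minus_commute)
    then show "z \<in> K" unfolding K_def using that by blast
  qed
  ultimately show thesis using that r(1) K by blast
qed

text \<open>The margin, the bound on \<open>f\<close> and the Lipschitz constant hold uniformly over
  the compact set \<open>C\<close>, and the existence time depends on nothing else. This uniformity
  is what later carries a solution past a supremum of visiting times.\<close>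

lemma local_existence_uniform:
  assumes "compact C" "C \<subseteq> D"
  obtains h where "h > 0" "\<And>x. x \<in> C \<Longrightarrow> {-h<..<h} \<subseteq> existence_interval D f x"
proof -
  obtain r K L where r: "r > 0" and tube: "\<And>x z. x \<in> C \<Longrightarrow> dist z x \<le> r \<Longrightarrow> z \<in> K"
    and K: "compact K" "K \<subseteq> D" and L: "L-lipschitz_on K f"
    using lipschitz_tube[OF assms] by metis
  have cball_K: "cball x r \<subseteq> K" if "x \<in> C" for x
    using tube[OF that] by (auto simp: dist_commute)
  have "bounded (f ` K)"
    using compact_continuous_image[OF lipschitz_on_continuous_on[OF L] K(1)]
    by (rule compact_imp_bounded)
  then obtain M where M: "M > 0" "\<And>x. x \<in> K \<Longrightarrow> norm (f x) \<le> M"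
    by (auto simp: bounded_pos)
  have L0: "0 \<le> L" using L by (rule lipschitz_on_nonneg)
  \<comment> \<open>The first term keeps the solution within distance \<open>r\<close> of its start,
    the second makes the contraction factor \<open>4 * h * L\<close> less than 1; the summand 1
    covers \<open>L = 0\<close>.\<close>
  define h where "h = min (r / (4 * M)) (1 / (8 * (L + 1)))"
  have h: "h > 0" using M(1) r L0 by (simp add: h_def)
  have hM: "4 * h * M \<le> r"
    using mult_right_mono[of h "r / (4 * M)" "4 * M"] M(1) by (simp add: h_def field_simps)
  have "8 * (L + 1) * h \<le> 1"
    using mult_right_mono[of h "1 / (8 * (L + 1))" "8 * (L + 1)"] L0 by (simp add: h_def field_simps)
  then have hL: "4 * h * L < 1"
    using mult_nonneg_nonneg[of h L] h L0 by (simp add: algebra_simps)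
  have "{-h<..<h} \<subseteq> existence_interval D f x" if "x \<in> C" for x
  proof -
    \<comment> \<open>Nearest-point projection onto a closed ball is nonexpansive, so
      \<open>f\<close> composed with \<open>p\<close> is globally Lipschitz with the same constant,
      and bounded. The solution stays in the ball, where \<open>p\<close> is the identity, so it
      solves the original equation.\<close>
    define p where "p = closest_point (cball x r)"
    have p: "p z \<in> cball x r" for z
      using r unfolding p_def by (intro closest_point_in_set) auto
    have p_lip: "dist (p y) (p z) \<le> dist y z" for y z
      using r unfolding p_def by (intro closest_point_lipschitz) auto
    have g_lip: "L-lipschitz_on UNIV (\<lambda>z. f (p z))"
    proof (rule lipschitz_onI[OF _ L0])
      fix y z
      have "dist (f (p y)) (f (p z)) \<le> L * dist (p y) (p z)"
        using p cball_K[OF that] by (intro lipschitz_onD[OF L]) auto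
      also have "\<dots> \<le> L * dist y z" by (intro mult_left_mono p_lip L0)
      finally show "dist (f (p y)) (f (p z)) \<le> L * dist y z" .
    qed
    have g_bd: "norm (f (p z)) \<le> M" for z
      using M(2) p cball_K[OF that] by blast
    obtain u where u: "u 0 = x" "\<And>t. norm (u t - x) \<le> 4 * h * M"
        "\<And>t. t \<in> {-h<..<h} \<Longrightarrow> (u has_vector_derivative f (p (u t))) (at t)"
      using picard_lindelof_bounded[OF g_lip g_bd h hL, of x] by blast
    have in_ball: "u t \<in> cball x r" for t
      using order_trans[OF u(2) hM, of t] by (simp add: dist_norm norm_minus_commute)
    have "ivp_solution D f x {-h<..<h} u"
      unfolding ivp_solution_def
    proof (intro conjI ballI)
      fix t assume t: "t \<in> {-h<..<h}"
      show "u t \<in> D" using in_ball cball_K[OF that] K(2) by blast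
      show "(u has_vector_derivative f (u t)) (at t)"
        using u(3)[OF t] closest_point_self[OF in_ball] by (simp add: p_def)
    qed (use u(1) h in \<open>auto simp: is_interval_1\<close>)
    then show ?thesis unfolding existence_interval_def by blast
  qed
  with h show thesis by (rule that)
qed

section \<open>The flow as the maximal solution\<close>

text \<open>Justifies the choice operator in \<open>flow\<close>: local existence makes the
  existence interval nonempty, and a solution on all of it is then available.\<close>

lemma ivp_solution_flow:
  assumes "x \<in> D"
  shows "ivp_solution D f x (existence_interval D f x) (\<lambda>t. flow D f t x)"
proof -
  obtain h where "h > 0" "{-h<..<h} \<subseteq> existence_interval D f x"
    using local_existence_uniform[of "{x}"] assms by auto
  then have "0 \<in> existence_interval D f x" by auto
  then have "\<exists>u. ivp_solution D f x (existence_interval D f x) u"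
    by (intro maximal_ivp_solution_exists) auto
  from someI_ex[OF this] show ?thesis by (simp add: flow_def)
qed

lemma ivp_solution_imp_flow:
  assumes "ivp_solution D f x J u" "t \<in> J"
  shows "t \<in> existence_interval D f x" "flow D f t x = u t"
proof -
  show t: "t \<in> existence_interval D f x"
    using assms by (auto simp: existence_interval_def)
  have "x \<in> D" using assms by (auto simp: ivp_solution_def)
  note flow = ivp_solution_flow[OF this]
  have "flow D f 0 x = u 0" "0 \<in> existence_interval D f x \<inter> J"
    using flow assms(1) by (auto simp: ivp_solution_def)
  then show "flow D f t x = u t"
    using ivp_solution_unique[OF flow assms(1), of 0 t] assms(2) t by blast
qed

lemma existence_interval:
  assumes "x \<in> D"
  shows "open (existence_interval D f x)" "is_interval (existence_interval D f x)"
    "0 \<in> existence_interval D f x" "flow D f 0 x = x"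
  using ivp_solution_flow[OF assms] by (auto simp: ivp_solution_def)

lemma flow_in_domain: "x \<in> D \<Longrightarrow> t \<in> existence_interval D f x \<Longrightarrow> flow D f t x \<in> D"
  using ivp_solution_flow by (auto simp: ivp_solution_def)

lemma flow_has_vector_derivative:
  "x \<in> D \<Longrightarrow> t \<in> existence_interval D f x \<Longrightarrow>
    ((\<lambda>t. flow D f t x) has_vector_derivative f (flow D f t x)) (at t)"
  using ivp_solution_flow by (auto simp: ivp_solution_def)

lemma flow_continuous_on:
  "x \<in> D \<Longrightarrow> X \<subseteq> existence_interval D f x \<Longrightarrow> continuous_on X (\<lambda>t. flow D f t x)"
  using ivp_solution_continuous_on[OF ivp_solution_flow] .

text \<open>The solution through \<open>flow D f t x\<close>, shifted back by \<open>t\<close>,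
  starts at \<open>x\<close> again. Maximality of the existence interval of \<open>x\<close> gives
  the first claim and uniqueness the second.\<close>

lemma flow_add:
  assumes x: "x \<in> D" and t: "t \<in> existence_interval D f x"
    and s: "s \<in> existence_interval D f (flow D f t x)"
  shows "t + s \<in> existence_interval D f x" "flow D f (t + s) x = flow D f s (flow D f t x)"
proof -
  let ?y = "flow D f t x" and ?I = "existence_interval D f x"
  have y: "?y \<in> D" using flow_in_domain[OF x t] .
  have mt: "- t \<in> existence_interval D f ?y" and backward: "flow D f (- t) ?y = x"
    using ivp_solution_imp_flow[OF ivp_solution_shift[OF ivp_solution_flow[OF x] t], of "- t"]
      existence_interval[OF x] by auto
  have *: "ivp_solution D f x {r. r + - t \<in> existence_interval D f ?y} (\<lambda>r. flow D f (r + - t) ?y)"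
    using ivp_solution_shift[OF ivp_solution_flow[OF y] mt] by (simp add: backward)
  from ivp_solution_imp_flow[OF *, of "t + s"] s
  show "t + s \<in> ?I" "flow D f (t + s) x = flow D f s ?y" by auto
qed

lemma existence_interval_atLeast_flow:
  assumes x: "x \<in> D" and global: "{0..} \<subseteq> existence_interval D f x" and "0 \<le> t"
  shows "{0..} \<subseteq> existence_interval D f (flow D f t x)"
proof
  fix s :: real assume "s \<in> {0..}"
  then have "s + t \<in> existence_interval D f x" "t \<in> existence_interval D f x"
    using global \<open>0 \<le> t\<close> by auto
  then show "s \<in> existence_interval D f (flow D f t x)"
    using ivp_solution_imp_flow[OF ivp_solution_shift[OF ivp_solution_flow[OF x]], of t s] by auto
qed

section \<open>Continuous dependence on the initial value\<close>

text \<open>The Gronwall inequality applies as long as the second trajectory stays within the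
  compact neighbourhood of the first, and a first-exit argument shows that it does. Existence of the
  second trajectory on \<open>{0..b}\<close> is assumed here; in the applications it comes from
  global existence.\<close>

lemma flow_dependence:
  assumes x: "x \<in> D" and "0 \<le> b" and xb: "{0..b} \<subseteq> existence_interval D f x"
  obtains \<delta> M where "\<delta> > 0"
    "\<And>y t. y \<in> D \<Longrightarrow> dist y x < \<delta> \<Longrightarrow> {0..b} \<subseteq> existence_interval D f y \<Longrightarrow> t \<in> {0..b} \<Longrightarrow>
      dist (flow D f t y) (flow D f t x) \<le> M * dist y x"
proof -
  define C where "C = (\<lambda>t. flow D f t x) ` {0..b}"
  have "compact C"
    unfolding C_def by (intro compact_continuous_image flow_continuous_on x xb) auto
  moreover have "C \<subseteq> D" unfolding C_def using flow_in_domain[OF x] xb by auto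
  ultimately obtain r K M where r: "r > 0"
    and cball_K: "\<And>w z. w \<in> C \<Longrightarrow> dist z w \<le> r \<Longrightarrow> z \<in> K"
    and K: "compact K" "K \<subseteq> D" and M: "M-lipschitz_on K f"
    using lipschitz_tube by metis
  have M0: "0 \<le> M" using M by (rule lipschitz_on_nonneg)
  show thesis
  proof (rule that)
    \<comment> \<open>Initial distances below this \<delta> cannot grow to \<open>r\<close> by time
      \<open>b\<close> at the Gronwall rate.\<close>
    show "r / exp (M * b) > 0" using r by simp
    fix y t assume y: "y \<in> D" "{0..b} \<subseteq> existence_interval D f y" and t: "t \<in> {0..b}"
      and "dist y x < r / exp (M * b)"
    then have small: "exp (M * b) * dist y x < r" by (simp add: field_simps)
    define d where "d t = dist (flow D f t y) (flow D f t x)" for t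
    have d_cont: "continuous_on {0..b} d"
      unfolding d_def by (intro continuous_intros flow_continuous_on x y xb)
    have gron: "d t \<le> exp (M * b) * dist y x"
      if t: "t \<in> {0..b}" and tube: "\<And>s. s \<in> {0..t} \<Longrightarrow> d s \<le> r" for t
    proof -
      have "norm (flow D f t y - flow D f t x) \<le> exp (M * (t - 0)) * norm (flow D f 0 y - flow D f 0 x)"
      proof (rule gronwall_lipschitz[OF M])
        fix s assume s: "s \<in> {0..t}"
        then have s': "s \<in> existence_interval D f x" "s \<in> existence_interval D f y" "flow D f s x \<in> C"
          using t xb y(2) by (auto simp: C_def)
        then show "flow D f s y \<in> K \<and>
            ((\<lambda>t. flow D f t y) has_vector_derivative f (flow D f s y)) (at s)"
          "flow D f s x \<in> K \<and>
            ((\<lambda>t. flow D f t x) has_vector_derivative f (flow D f s x)) (at s)"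
          using tube[OF s] r x y(1) flow_has_vector_derivative cball_K unfolding d_def by auto
      qed (use t in auto)
      also have "\<dots> = exp (M * t) * dist y x"
        using existence_interval(4) x y(1) by (simp add: dist_norm)
      also have "\<dots> \<le> exp (M * b) * dist y x"
        using t M0 by (intro mult_right_mono) (auto intro: mult_left_mono)
      finally show ?thesis by (simp add: d_def dist_norm)
    qed
    \<comment> \<open>At the first time \<open>s0\<close> with distance at least \<open>r\<close>
      the distance equals \<open>r\<close>. Up to \<open>s0\<close> the trajectory is in the
      neighbourhood, so \<open>gron\<close> makes the distance at \<open>s0\<close> strictly smaller
      than \<open>r\<close>, a contradiction.\<close>
    have "d s \<le> r" if "s \<in> {0..b}" for s
    proof (rule ccontr)
      assume "\<not> d s \<le> r"
      then have neg: "s \<in> {0..b} \<inter> d -` {r..}" using that by auto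
      have "closed ({0..b} \<inter> d -` {r..})"
        by (intro continuous_closed_preimage d_cont) auto
      then have "compact ({0..b} \<inter> d -` {r..})"
        by (metis Int_lower1 bounded_closed_interval bounded_subset compact_eq_bounded_closed)
      moreover have "{0..b} \<inter> d -` {r..} \<noteq> {}" using neg by blast
      ultimately obtain s0 where "s0 \<in> {0..b} \<inter> d -` {r..}"
          "\<forall>s\<in>{0..b} \<inter> d -` {r..}. s0 \<le> s"
        using compact_attains_inf by metis
      then have s0: "s0 \<in> {0..b}" "d s0 \<ge> r" "\<And>s. s \<in> {0..b} \<Longrightarrow> d s \<ge> r \<Longrightarrow> s0 \<le> s"
        by auto
      have "d 0 < r"
      proof -
        have "1 * dist y x \<le> exp (M * b) * dist y x"
          using M0 \<open>0 \<le> b\<close> by (intro mult_right_mono) auto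
        then show ?thesis using small existence_interval(4) x y(1) by (simp add: d_def)
      qed
      obtain s1 where "0 \<le> s1" "s1 \<le> s0" "d s1 = r"
        using IVT'[of d 0 r s0] \<open>d 0 < r\<close> s0 continuous_on_subset[OF d_cont] by auto
      then have "d s0 = r" using s0(1) s0(3)[of s1] by auto
      then have "d s \<le> r" if "s \<in> {0..s0}" for s
        using s0(1) s0(3)[of s] that \<open>d s0 = r\<close> by (cases "d s \<le> r") auto
      then show False using gron[OF s0(1)] small \<open>d s0 = r\<close> by auto
    qed
    then show "dist (flow D f t y) (flow D f t x) \<le> exp (M * b) * dist y x"
      using gron[OF t] t by (auto simp: d_def)
  qed
qed

text \<open>Along a convergent sequence of pairs the error splits in two: a change of initial value
  at the same time, controlled by a bound that is uniform in time, and a change of time along the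
  limiting trajectory.\<close>

lemma continuous_on_flow:
  assumes "A \<subseteq> D" "0 \<le> b" and ex: "\<And>x. x \<in> A \<Longrightarrow> {0..b} \<subseteq> existence_interval D f x"
  shows "continuous_on ({0..b} \<times> A) (\<lambda>(t, x). flow D f t x)"
  unfolding continuous_on_sequentially
proof (intro allI ballI impI, elim conjE)
  fix p and q :: "real \<times> (real ^ 'd)"
  assume q: "q \<in> {0..b} \<times> A" and "\<forall>n. p n \<in> {0..b} \<times> A" and lim: "p \<longlonglongrightarrow> q"
  then have p: "fst (p n) \<in> {0..b}" "snd (p n) \<in> A" for n by (auto simp: mem_Times_iff)
  obtain s x where sx: "q = (s, x)" by (cases q)
  have x: "x \<in> A" "s \<in> {0..b}" using q sx by auto
  have lim1: "(\<lambda>n. fst (p n)) \<longlonglongrightarrow> s" and lim2: "(\<lambda>n. snd (p n)) \<longlonglongrightarrow> x"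
    using tendsto_fst[OF lim] tendsto_snd[OF lim] by (simp_all add: sx)
  obtain \<delta> M where "\<delta> > 0" and dep: "\<And>y t. y \<in> D \<Longrightarrow> dist y x < \<delta> \<Longrightarrow>
      {0..b} \<subseteq> existence_interval D f y \<Longrightarrow> t \<in> {0..b} \<Longrightarrow>
      dist (flow D f t y) (flow D f t x) \<le> M * dist y x"
    using flow_dependence[of x b] assms x by (metis subsetD)
  have "(\<lambda>n. M * dist (snd (p n)) x) \<longlonglongrightarrow> M * dist x x"
    by (intro tendsto_intros lim2)
  moreover have "\<forall>\<^sub>F n in sequentially.
      norm (flow D f (fst (p n)) (snd (p n)) - flow D f (fst (p n)) x) \<le> M * dist (snd (p n)) x"
    using tendstoD[OF lim2 \<open>\<delta> > 0\<close>] unfolding dist_norm[symmetric]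
    by eventually_elim (use p assms(1) in \<open>intro dep ex; blast\<close>)
  ultimately have "(\<lambda>n. flow D f (fst (p n)) (snd (p n)) - flow D f (fst (p n)) x) \<longlonglongrightarrow> 0"
    using Lim_null_comparison by fastforce
  moreover have "(\<lambda>n. flow D f (fst (p n)) x) \<longlonglongrightarrow> flow D f s x"
    using flow_continuous_on[OF _ ex[OF x(1)]] x assms(1) p lim1
    unfolding continuous_on_sequentially by (auto simp: o_def)
  ultimately have "(\<lambda>n. flow D f (fst (p n)) (snd (p n))) \<longlonglongrightarrow> flow D f s x"
    by (rule Lim_transform[rotated])
  then show "((\<lambda>(t, x). flow D f t x) \<circ> p) \<longlonglongrightarrow> (case q of (t, x) \<Rightarrow> flow D f t x)"
    by (simp add: o_def sx case_prod_beta)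
qed

end

section \<open>Norms, weak pairings and Dini derivatives\<close>

lemma vector_norm_upper_bound:
  fixes N :: "real ^ 'd \<Rightarrow> real"
  assumes N: "vector_norm N"
  obtains C where "C > 0" "\<And>x. N x \<le> C * norm x"
proof -
  have N0: "N 0 = 0" and N_pos: "x \<noteq> 0 \<Longrightarrow> N x > 0" and N_scale: "N (r *\<^sub>R x) = \<bar>r\<bar> * N x"
    and N_add: "N (x + y) \<le> N x + N y" for x y r
    using N by (auto simp: vector_norm_def less_le)
  have N_sum: "N (\<Sum>b\<in>A. g b) \<le> (\<Sum>b\<in>A. N (g b))" if "finite A"
    for g :: "real ^ 'd \<Rightarrow> real ^ 'd" and A
    using that by induction (auto simp: N0 intro: order_trans[OF N_add])
  define C where "C = (\<Sum>b\<in>(Basis :: (real ^ 'd) set). N b)"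
  have "C > 0"
    unfolding C_def by (intro sum_pos) (auto intro!: N_pos)
  moreover have "N x \<le> C * norm x" for x
  proof -
    have "N x = N (\<Sum>b\<in>Basis. (x \<bullet> b) *\<^sub>R b)" by (simp add: euclidean_representation)
    also have "\<dots> \<le> (\<Sum>b\<in>Basis. \<bar>x \<bullet> b\<bar> * N b)"
      using N_sum[OF finite_Basis, of "\<lambda>b. (x \<bullet> b) *\<^sub>R b"] by (simp only: N_scale)
    also have "\<dots> \<le> (\<Sum>b\<in>Basis. norm x * N b)"
      using N by (intro sum_mono mult_right_mono) (auto simp: Basis_le_norm vector_norm_def)
    finally show ?thesis by (simp add: C_def sum_distrib_left mult.commute)
  qed
  ultimately show thesis by (rule that)
qed

lemma vector_norm_continuous_on:
  assumes N: "vector_norm N"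
  shows "continuous_on X N"
proof -
  obtain C where C: "C > 0" "\<And>x. N x \<le> C * norm x"
    using vector_norm_upper_bound[OF N] by blast
  have "C-lipschitz_on X N"
  proof (rule lipschitz_onI)
    fix x y
    have "N x \<le> N y + N (x - y)" "N y \<le> N x + N (y - x)"
      using N unfolding vector_norm_def by (metis add.commute diff_add_cancel)+
    then show "dist (N x) (N y) \<le> C * dist x y"
      using C(2)[of "x - y"] C(2)[of "y - x"] by (auto simp: dist_norm norm_minus_commute)
  qed (use C in simp)
  then show ?thesis by (rule lipschitz_on_continuous_on)
qed

text \<open>The constant is the minimum of \<open>N\<close> on the Euclidean unit sphere, attained
  by compactness; homogeneity extends the bound to all vectors.\<close>

lemma vector_norm_lower_bound:
  fixes N :: "real ^ 'd \<Rightarrow> real"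
  assumes N: "vector_norm N"
  obtains c where "c > 0" "\<And>x. c * norm x \<le> N x"
proof -
  have "sphere (0 :: real ^ 'd) 1 \<noteq> {}" by simp
  then obtain z where z: "z \<in> sphere 0 1" "\<And>x. x \<in> sphere 0 1 \<Longrightarrow> N z \<le> N x"
    using continuous_attains_inf[OF compact_sphere _ vector_norm_continuous_on[OF N]] by metis
  have "N z * norm x \<le> N x" for x
  proof (cases "x = 0")
    case True
    then show ?thesis using N by (simp add: vector_norm_def)
  next
    case False
    have "N z \<le> N ((1 / norm x) *\<^sub>R x)" using False by (intro z(2)) simp
    also have "\<dots> = N x / norm x" using N unfolding vector_norm_def by simp
    finally show ?thesis using False by (simp add: field_simps)
  qed
  moreover have "N z > 0" using z(1) N by (auto simp: vector_norm_def less_le)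
  ultimately show thesis using that by blast
qed

lemma continuous_on_vector_norm [continuous_intros]:
  assumes "vector_norm N" "continuous_on X g"
  shows "continuous_on X (\<lambda>x. N (g x))"
  by (rule continuous_on_compose2[OF vector_norm_continuous_on[OF assms(1), of UNIV] assms(2)]) auto

lemma compact_norm_ball:
  assumes N: "vector_norm N"
  shows "compact (norm_ball N x r)"
proof -
  obtain c where c: "c > 0" "\<And>x. c * norm x \<le> N x"
    using vector_norm_lower_bound[OF N] by blast
  have "norm (y - x) \<le> r / c" if "y \<in> norm_ball N x r" for y
    using c(2)[of "y - x"] that c(1) by (simp add: norm_ball_def field_simps)
  then have "norm_ball N x r \<subseteq> cball x (r / c)"
    by (auto simp: dist_norm norm_minus_commute)
  moreover have "closed (norm_ball N x r)"
    unfolding norm_ball_def by (intro closed_Collect_le continuous_intros N)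
  ultimately show ?thesis
    using bounded_subset[OF bounded_cball] compact_eq_bounded_closed by blast
qed

lemma locally_lipschitz_compact:
  assumes N: "vector_norm N" and f: "locally_lipschitz N D f" and K: "compact K" "K \<subseteq> D"
  shows "\<exists>M. M-lipschitz_on K f"
proof -
  obtain L where L: "L \<ge> 0" "\<And>x y. x \<in> K \<Longrightarrow> y \<in> K \<Longrightarrow> N (f y - f x) \<le> L * N (y - x)"
    using f K unfolding locally_lipschitz_def by metis
  obtain c C where c: "c > 0" "C > 0" "\<And>x. c * norm x \<le> N x" "\<And>x. N x \<le> C * norm x"
    using vector_norm_lower_bound[OF N] vector_norm_upper_bound[OF N] by metis
  have "(L * C / c)-lipschitz_on K f"
  proof (rule lipschitz_onI)
    fix x y assume "x \<in> K" "y \<in> K"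
    then have "c * norm (f x - f y) \<le> L * N (x - y)"
      using c(3)[of "f x - f y"] L(2)[of y x] by simp
    also have "\<dots> \<le> L * (C * norm (x - y))" by (intro mult_left_mono c L)
    finally show "dist (f x) (f y) \<le> L * C / c * dist x y"
      using c(1) by (simp add: dist_norm field_simps)
  qed (use L c in simp)
  then show ?thesis ..
qed

section \<open>Differential inequalities for Dini derivatives\<close>

text \<open>If \<open>w\<close> ended above \<open>z\<close>, there would be a last time
  \<open>t0\<close> with \<open>w\<close> at most \<open>z\<close>. There the two agree and
  \<open>w\<close> exceeds \<open>z\<close> immediately afterwards, so the upper right derivative of
  \<open>w\<close> is at least that of \<open>z\<close>, against the strict hypothesis. Strictness
  at \<open>a\<close> places \<open>t0\<close> in the open interval, where that hypothesis is
  available.\<close>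

lemma dini_comparison:
  fixes w z :: "real \<Rightarrow> real"
  assumes "a \<le> b" and w: "continuous_on {a..b} w" and "w a < z a"
    and z: "\<And>t. t \<in> {a..b} \<Longrightarrow> (z has_real_derivative z' t) (at t)"
    and dini: "\<And>t. t \<in> {a<..<b} \<Longrightarrow> w t = z t \<Longrightarrow> upper_right_dini w t < ereal (z' t)"
  shows "w b \<le> z b"
proof (rule ccontr)
  assume "\<not> w b \<le> z b"
  define e where "e t = w t - z t" for t
  have "continuous_on {a..b} z"
    using z DERIV_isCont continuous_at_imp_continuous_on by blast
  then have e_cont: "continuous_on {a..b} e"
    unfolding e_def using w by (intro continuous_intros)
  have "closed ({a..b} \<inter> e -` {..0})"
    by (intro continuous_closed_preimage e_cont) auto
  then have "compact ({a..b} \<inter> e -` {..0})"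
    by (metis Int_lower1 bounded_closed_interval bounded_subset compact_eq_bounded_closed)
  moreover have "{a..b} \<inter> e -` {..0} \<noteq> {}"
    using assms(1,3) by (auto simp: e_def intro!: bexI[of _ a] simp: Int_def)
  ultimately obtain t0 where "t0 \<in> {a..b} \<inter> e -` {..0}" "\<forall>t\<in>{a..b} \<inter> e -` {..0}. t \<le> t0"
    using compact_attains_sup by metis
  then have t0: "t0 \<in> {a..b}" "e t0 \<le> 0" and max: "\<And>t. t \<in> {a..b} \<Longrightarrow> e t \<le> 0 \<Longrightarrow> t \<le> t0"
    by auto
  have eb: "e b > 0" using \<open>\<not> w b \<le> z b\<close> by (simp add: e_def)
  have "t0 < b" using t0 eb by (cases "t0 = b") auto
  obtain t1 where "t0 \<le> t1" "t1 \<le> b" "e t1 = 0"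
    using IVT'[of e t0 0 b] t0 eb \<open>t0 < b\<close> continuous_on_subset[OF e_cont, of "{t0..b}"] by auto
  then have e0: "e t0 = 0" using max[of t1] t0 by auto
  then have "t0 \<noteq> a" using assms(3) by (auto simp: e_def)
  then have t0': "t0 \<in> {a<..<b}" using t0 \<open>t0 < b\<close> by auto
  have "(\<lambda>h. (z (t0 + h) - z t0) / h) \<midarrow>0\<rightarrow> z' t0"
    using z[OF t0(1)] by (simp add: DERIV_def)
  then have "((\<lambda>h. (z (t0 + h) - z t0) / h) \<longlongrightarrow> z' t0) (at_right 0)"
    by (rule tendsto_within_subset) simp
  then have "((\<lambda>h. ereal ((z (t0 + h) - z t0) / h)) \<longlongrightarrow> ereal (z' t0)) (at_right 0)"
    by (rule tendsto_ereal)
  then have "ereal (z' t0) = Limsup (at_right 0) (\<lambda>h. ereal ((z (t0 + h) - z t0) / h))"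
    by (intro lim_imp_Limsup[symmetric]) auto
  also have "\<dots> \<le> upper_right_dini w t0"
    unfolding upper_right_dini_def
  proof (rule Limsup_mono)
    have "\<forall>\<^sub>F h in at_right 0. h < b - t0 \<and> 0 < h"
      using \<open>t0 < b\<close> by (auto simp: eventually_at_right_field intro!: exI[of _ "b - t0"])
    then show "\<forall>\<^sub>F h in at_right 0. ereal ((z (t0 + h) - z t0) / h) \<le> ereal ((w (t0 + h) - w t0) / h)"
    proof eventually_elim
      case (elim h)
      then have "e (t0 + h) > 0" using max[of "t0 + h"] t0(1) by (cases "e (t0 + h) \<le> 0") auto
      then show ?case using e0 elim by (auto simp: e_def divide_right_mono)
    qed
  qed
  finally show False using dini[OF t0'] e0 by (simp add: e_def)
qed

lemma growth_factor_0 [simp]: "growth_factor 0 L = 0"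
  by (simp add: growth_factor_def)

text \<open>This form is valid for \<open>L = 0\<close> too, which spares a case distinction when
  the comparison function is differentiated.\<close>

lemma growth_factor_mult: "L * growth_factor t L = exp (L * t) - 1"
  by (simp add: growth_factor_def)

lemma growth_factor_has_derivative:
  "((\<lambda>t. growth_factor t L) has_real_derivative exp (L * t)) (at t)"
  unfolding growth_factor_def by (cases "L = 0") (auto intro!: derivative_eq_intros)

lemma growth_factor_mono: "s \<le> t \<Longrightarrow> growth_factor s L \<le> growth_factor t L"
  by (rule DERIV_nonneg_imp_nondecreasing[where f = "\<lambda>t. growth_factor t L"])
    (auto intro!: exI[of _ "exp (L * _)"] growth_factor_has_derivative)

lemma growth_factor_nonneg: "0 \<le> t \<Longrightarrow> 0 \<le> growth_factor t L"
  using growth_factor_mono[of 0 t L] by simp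

text \<open>The bound \<open>F * growth_factor t L\<close> solves \<open>z' = L * z + F\<close> with
  \<open>z 0 = 0\<close>. Comparison needs strict inequalities, so initial value and slope are
  raised by a small \<eta>. The Dini bound is asked only where \<open>w\<close> is positive; that
  suffices because the comparison function is positive at every touching time.\<close>

lemma dini_growth_estimate:
  fixes w :: "real \<Rightarrow> real"
  assumes "0 \<le> b" and w: "continuous_on {0..b} w" and "w 0 = 0" and "0 \<le> F"
    and dini: "\<And>t. t \<in> {0<..<b} \<Longrightarrow> w t > 0 \<Longrightarrow> upper_right_dini w t \<le> ereal (L * w t + F)"
  shows "w b \<le> F * growth_factor b L"
proof (rule field_le_epsilon)
  fix e :: real assume "e > 0"
  \<comment> \<open>Chosen so that the perturbation raises the final bound by exactly
    \<open>e\<close>.\<close>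
  define \<eta> where "\<eta> = e / (exp (L * b) + growth_factor b L)"
  have pos: "exp (L * b) + growth_factor b L > 0"
    using growth_factor_nonneg[OF \<open>0 \<le> b\<close>, of L] by (simp add: add_pos_nonneg)
  then have \<eta>: "\<eta> > 0" using \<open>e > 0\<close> by (simp add: \<eta>_def)
  define z where "z t = \<eta> * exp (L * t) + (F + \<eta>) * growth_factor t L" for t
  have z_deriv: "(z has_real_derivative L * z t + F + \<eta>) (at t)" for t
  proof -
    have "(z has_real_derivative \<eta> * (exp (L * t) * L) + (F + \<eta>) * exp (L * t)) (at t)"
      unfolding z_def
      by (auto intro!: derivative_eq_intros growth_factor_has_derivative)
    moreover have "L * z t = \<eta> * (exp (L * t) * L) + (F + \<eta>) * (exp (L * t) - 1)"
      unfolding z_def growth_factor_mult[symmetric] by (simp add: algebra_simps)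
    ultimately show ?thesis by (simp add: algebra_simps)
  qed
  have "w b \<le> z b"
  proof (rule dini_comparison[OF \<open>0 \<le> b\<close> w _ z_deriv])
    show "w 0 < z 0" using \<open>w 0 = 0\<close> \<eta> by (simp add: z_def)
    fix t assume t: "t \<in> {0<..<b}" and eq: "w t = z t"
    have "z t > 0"
      unfolding z_def using t \<eta> \<open>0 \<le> F\<close> growth_factor_nonneg[of t L]
      by (intro add_pos_nonneg) auto
    then show "upper_right_dini w t < ereal (L * z t + F + \<eta>)"
      using dini[OF t] eq \<eta> by (auto intro: le_less_trans)
  qed
  also have "z b = F * growth_factor b L + \<eta> * (exp (L * b) + growth_factor b L)"
    by (simp add: z_def algebra_simps)
  also have "\<dots> = F * growth_factor b L + e" using pos by (simp add: \<eta>_def)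
  finally show "w b \<le> F * growth_factor b L + e" .
qed

section \<open>Weak pairings and the displacement along an orbit\<close>

text \<open>The curve norm derivative formula can be divided by the norm where it is positive. An
  infinite Dini derivative is excluded there, since its product with a positive real would be
  infinite while the right-hand side is finite.\<close>

lemma upper_right_dini_curve_norm:
  assumes assoc: "associated_weak_pairing N P"
    and c: "\<And>t. t \<in> {a<..<b} \<Longrightarrow> (c has_vector_derivative c' t) (at t)"
    and t: "t \<in> {a<..<b}" and pos: "N (c t) > 0"
  shows "upper_right_dini (\<lambda>s. N (c s)) t = ereal (P (c' t) (c t) / N (c t))"
proof -
  have "ereal (N (c t)) * upper_right_dini (\<lambda>s. N (c s)) t = ereal (P (c' t) (c t))"
    using assoc c t unfolding associated_weak_pairing_def curve_norm_derivative_formula_def by blast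
  then show ?thesis
    using pos by (cases "upper_right_dini (\<lambda>s. N (c s)) t") (auto simp: field_simps)
qed

lemma weak_pairing_cauchy_schwarz:
  assumes "associated_weak_pairing N P"
  shows "P x y \<le> N x * N y"
  using assms abs_le_D1 unfolding associated_weak_pairing_def weak_pairing_def by metis

text \<open>The constant is a \<open>LEAST\<close> over the reals, which is meaningful only if the minimum is attained.\<close>

lemma one_sided_lipschitz_constant_bound:
  assumes N: "vector_norm N" and assoc: "associated_weak_pairing N P"
    and f: "locally_lipschitz N D f" and K: "compact K" "K \<subseteq> D"
    and "p \<in> K" "q \<in> K" "p \<noteq> q" and "x \<in> K" "y \<in> K"
  shows "P (f y - f x) (y - x) \<le> one_sided_lipschitz_constant N P f K * (N (y - x))\<^sup>2"
proof -
  define Q where "Q = {L. \<forall>x\<in>K. \<forall>y\<in>K. P (f y - f x) (y - x) \<le> L * (N (y - x))\<^sup>2}"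
  have N_pos: "N (y - x) > 0" if "x \<noteq> y" for x y
    using N that by (auto simp: vector_norm_def less_le)
  obtain M where M: "\<And>x y. x \<in> K \<Longrightarrow> y \<in> K \<Longrightarrow> N (f y - f x) \<le> M * N (y - x)"
    using f K unfolding locally_lipschitz_def by metis
  have "P (f y - f x) (y - x) \<le> M * (N (y - x))\<^sup>2" if "x \<in> K" "y \<in> K" for x y
  proof -
    have "P (f y - f x) (y - x) \<le> N (f y - f x) * N (y - x)"
      by (rule weak_pairing_cauchy_schwarz[OF assoc])
    also have "\<dots> \<le> M * N (y - x) * N (y - x)"
      using M[OF that] N by (intro mult_right_mono) (auto simp: vector_norm_def)
    finally show ?thesis by (simp add: power2_eq_square)
  qed
  then have "M \<in> Q" by (simp add: Q_def)
  have lower: "P (f y - f x) (y - x) / (N (y - x))\<^sup>2 \<le> L"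
    if "x \<in> K" "y \<in> K" "x \<noteq> y" "L \<in> Q" for x y L
    using that N_pos[of x y] by (auto simp: Q_def pos_divide_le_eq)
  \<comment> \<open>Two distinct points are essential: on a set with at most one point every real
    number is an admissible constant, and there is no least one.\<close>
  have bdd: "bdd_below Q"
    using lower[OF \<open>p \<in> K\<close> \<open>q \<in> K\<close> \<open>p \<noteq> q\<close>] by (meson bdd_belowI)
  have "Inf Q \<in> Q"
    unfolding Q_def
  proof (intro CollectI ballI, fold Q_def)
    fix x y assume xy: "x \<in> K" "y \<in> K"
    show "P (f y - f x) (y - x) \<le> Inf Q * (N (y - x))\<^sup>2"
    proof (cases "x = y")
      case True
      then have "N (y - x) = 0" using N by (simp add: vector_norm_def)
      then show ?thesis using \<open>M \<in> Q\<close> xy by (force simp: Q_def)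
    next
      case False
      have "P (f y - f x) (y - x) / (N (y - x))\<^sup>2 \<le> Inf Q"
        using \<open>M \<in> Q\<close> lower[OF xy False] by (intro cInf_greatest) auto
      then show ?thesis using N_pos[OF False] by (simp add: pos_divide_le_eq)
    qed
  qed
  moreover have "one_sided_lipschitz_constant N P f K = (LEAST L. L \<in> Q)"
    by (simp add: one_sided_lipschitz_constant_def Q_def)
  moreover have "(LEAST L. L \<in> Q) = Inf Q"
    using \<open>Inf Q \<in> Q\<close> by (intro Least_equality) (auto intro: cInf_lower bdd)
  ultimately show ?thesis using assms(9,10) by (simp add: Q_def)
qed

text \<open>With \<open>z\<close> the current point, split \<open>f z\<close> into
  \<open>f z - f y\<close> and \<open>f y\<close> inside the pairing with \<open>z - y\<close>.
  Subadditivity, the one-sided Lipschitz bound and Cauchy-Schwarz show that the distance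
  \<open>w\<close> from \<open>y\<close> has upper right derivative at most
  \<open>L * w + N (f y)\<close>, and it starts at 0.\<close>

lemma (in lipschitz_ode) flow_displacement:
  assumes N: "vector_norm N" and assoc: "associated_weak_pairing N P"
    and y: "y \<in> D" and "0 \<le> b" and ex: "{0..b} \<subseteq> existence_interval D f y"
    and K: "\<And>t. t \<in> {0..b} \<Longrightarrow> flow D f t y \<in> K"
    and L: "\<And>x z. x \<in> K \<Longrightarrow> z \<in> K \<Longrightarrow> P (f z - f x) (z - x) \<le> L * (N (z - x))\<^sup>2"
  shows "N (flow D f b y - y) \<le> N (f y) * growth_factor b L"
proof (rule dini_growth_estimate)
  show "continuous_on {0..b} (\<lambda>t. N (flow D f t y - y))"
    by (intro continuous_intros N flow_continuous_on y ex)
  have y0: "flow D f 0 y = y" using existence_interval(4)[OF y] .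
  then show "N (flow D f 0 y - y) = 0" using N by (simp add: vector_norm_def)
  show "0 \<le> N (f y)" using N by (simp add: vector_norm_def)
  have yK: "y \<in> K" using K[of 0] y0 \<open>0 \<le> b\<close> by simp
  fix t assume t: "t \<in> {0<..<b}" and pos: "N (flow D f t y - y) > 0"
  let ?z = "flow D f t y"
  have deriv: "((\<lambda>t. flow D f t y - y) has_vector_derivative f (flow D f s y)) (at s)"
    if "s \<in> {0<..<b}" for s
  proof -
    have "s \<in> existence_interval D f y" using ex that by auto
    from has_vector_derivative_diff[OF flow_has_vector_derivative[OF y this] has_vector_derivative_const]
    show ?thesis by simp
  qed
  have "P (f ?z) (?z - y) \<le> P (f ?z - f y) (?z - y) + P (f y) (?z - y)"
    using assoc unfolding associated_weak_pairing_def weak_pairing_def by (metis diff_add_cancel)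
  also have "\<dots> \<le> L * (N (?z - y))\<^sup>2 + N (f y) * N (?z - y)"
    using t by (intro add_mono L weak_pairing_cauchy_schwarz[OF assoc] yK K) auto
  finally have "P (f ?z) (?z - y) / N (?z - y) \<le> L * N (?z - y) + N (f y)"
    using pos by (simp add: field_simps power2_eq_square)
  then show "upper_right_dini (\<lambda>t. N (flow D f t y - y)) t \<le> ereal (L * N (?z - y) + N (f y))"
    using upper_right_dini_curve_norm[OF assoc deriv t pos] by simp
qed (rule \<open>0 \<le> b\<close>)

section \<open>Recurrence\<close>

locale norm_SRLF =
  fixes N :: "real ^ 'd \<Rightarrow> real" and P :: "real ^ 'd \<Rightarrow> real ^ 'd \<Rightarrow> real"
    and D S :: "(real ^ 'd) set" and f :: "real ^ 'd \<Rightarrow> real ^ 'd"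
    and xs :: "real ^ 'd" and \<epsilon> \<tau> :: real
  assumes N: "vector_norm N" and assoc: "associated_weak_pairing N P"
    and open_domain: "open D" and loc_lip: "locally_lipschitz N D f"
    and \<epsilon>_pos: "\<epsilon> > 0" and S: "compact S" "S \<subseteq> D"
    and ball_S: "norm_ball N xs \<epsilon> \<subseteq> interior S" and \<tau>_pos: "\<tau> > 0"
    and SRLF: "eps_SRLF N D f xs \<epsilon> S \<tau> (\<lambda>x. N (x - xs))"
begin

sublocale lipschitz_ode D f
  using open_domain locally_lipschitz_compact[OF N loc_lip] by unfold_locales

lemma N_nonneg: "0 \<le> N x"
  using N by (simp add: vector_norm_def)

lemma S_in_D: "x \<in> S \<Longrightarrow> x \<in> D"
  using S by blast

lemma ball_in_S: "x \<in> norm_ball N xs \<epsilon> \<Longrightarrow> x \<in> S"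
  using ball_S interior_subset by blast

lemma N_triangle: "N (x - z) \<le> N (x - y) + N (y - z)"
proof -
  have "N ((x - y) + (y - z)) \<le> N (x - y) + N (y - z)"
    using N unfolding vector_norm_def by blast
  then show ?thesis by simp
qed

lemma center_in_ball: "xs \<in> norm_ball N xs \<epsilon>"
proof -
  have "N 0 = 0" using N unfolding vector_norm_def by blast
  then show ?thesis using \<epsilon>_pos by (simp add: norm_ball_def)
qed

section \<open>Visits to \<open>S\<close> and global existence\<close>

text \<open>The closure in the SRLF condition also captures the sphere of radius \<epsilon>: its
  points are interior to \<open>S\<close> and are limits of points pushed radially outward. The
  later arguments apply the condition exactly at such boundary points.\<close>

lemma recurrence:
  assumes x: "x \<in> S" and far: "\<epsilon> \<le> N (x - xs)"
  obtains s where "0 < s" "s \<le> \<tau>" "s \<in> existence_interval D f x" "flow D f s x \<in> S"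
    "N (flow D f s x - xs) < N (x - xs)"
proof -
  have "x \<in> closure (S - norm_ball N xs \<epsilon>)"
  proof (cases "N (x - xs) = \<epsilon>")
    case False
    then have "x \<in> S - norm_ball N xs \<epsilon>" using x far by (simp add: norm_ball_def)
    then show ?thesis using closure_subset by blast
  next
    case True
    then have "x \<in> interior S" using ball_S by (auto simp: norm_ball_def)
    then obtain r where r: "r > 0" "ball x r \<subseteq> S"
      using open_contains_ball[of "interior S"] interior_subset[of S] by blast
    show ?thesis
      unfolding closure_approachable
    proof (intro allI impI)
      fix e :: real assume "e > 0"
      \<comment> \<open>The push is small enough for \<open>y\<close> to lie within \<open>e\<close>
        of \<open>x\<close> and within the ball around \<open>x\<close> contained in
        \<open>S\<close>, while the distance of \<open>y\<close> from \<open>xs\<close> becomes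
        \<open>(1 + \<eta>) * \<epsilon>\<close>.\<close>
      define \<eta> where "\<eta> = min e r / (2 * (norm (x - xs) + 1))"
      have np: "norm (x - xs) + 1 > 0" by (simp add: add_nonneg_pos)
      have \<eta>: "\<eta> > 0" using \<open>e > 0\<close> r(1) np by (simp add: \<eta>_def)
      define y where "y = x + \<eta> *\<^sub>R (x - xs)"
      have "dist y x = \<eta> * norm (x - xs)" using \<eta> by (simp add: y_def dist_norm)
      also have "\<dots> \<le> \<eta> * (norm (x - xs) + 1)" using \<eta> by (intro mult_left_mono) auto
      also have "\<dots> = min e r / 2" using np by (simp add: \<eta>_def field_simps)
      finally have d: "dist y x < e" "dist y x < r" using \<open>e > 0\<close> r(1) by auto
      have "y - xs = (1 + \<eta>) *\<^sub>R (x - xs)" by (simp add: y_def algebra_simps)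
      then have "N (y - xs) = \<bar>1 + \<eta>\<bar> * N (x - xs)"
        using N unfolding vector_norm_def by metis
      then have "N (y - xs) > \<epsilon>" using True \<eta> \<epsilon>_pos by (simp add: algebra_simps)
      then have "y \<notin> norm_ball N xs \<epsilon>" by (simp add: norm_ball_def)
      moreover have "y \<in> S" using d(2) r(2) by (auto simp: dist_commute)
      ultimately show "\<exists>y\<in>S - norm_ball N xs \<epsilon>. dist y x < e" using d(1) by blast
    qed
  qed
  then show thesis
    using SRLF that unfolding eps_SRLF_def containment_times_def by fastforce
qed

text \<open>The return time is positive but has no lower bound, which is why
  \<open>visits_unbounded\<close> argues through a supremum instead of adding up return
  times.\<close>

lemma returns:
  assumes x: "x \<in> S"
  obtains s where "0 < s" "s \<in> existence_interval D f x" "flow D f s x \<in> S"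
proof (cases "\<epsilon> \<le> N (x - xs)")
  case True
  then show thesis using recurrence[OF x] that by metis
next
  case False
  then have int: "x \<in> interior S" using ball_S by (auto simp: norm_ball_def)
  have xD: "x \<in> D" using S_in_D[OF x] .
  let ?I = "existence_interval D f x"
  have "open (?I \<inter> (\<lambda>t. flow D f t x) -` interior S)"
    by (intro continuous_open_preimage flow_continuous_on xD existence_interval) auto
  moreover have "0 \<in> ?I \<inter> (\<lambda>t. flow D f t x) -` interior S"
    using existence_interval[OF xD] int by simp
  ultimately obtain e where e: "e > 0" "ball 0 e \<subseteq> ?I \<inter> (\<lambda>t. flow D f t x) -` interior S"
    using open_contains_ball by metis
  moreover have "e / 2 \<in> ball 0 e" using e(1) by (simp add: dist_norm)
  ultimately have "e / 2 \<in> ?I \<inter> (\<lambda>t. flow D f t x) -` interior S" by blast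
  then show thesis using that[of "e / 2"] e(1) interior_subset[of S] by auto
qed

text \<open>Suppose the visiting times had a supremum \<open>T\<close>. The solution exists at
  \<open>T\<close> by uniform local existence, \<open>T\<close> is itself a visiting time because
  \<open>S\<close> is closed, and a return from there is a visit after \<open>T\<close>.\<close>

lemma visits_unbounded:
  assumes x: "x \<in> S"
  obtains t where "b \<le> t" "0 \<le> t" "t \<in> existence_interval D f x" "flow D f t x \<in> S"
proof (rule ccontr)
  assume no: "\<not> thesis"
  let ?I = "existence_interval D f x"
  have xD: "x \<in> D" using S_in_D[OF x] .
  define A where "A = {t. 0 \<le> t \<and> t \<in> ?I \<and> flow D f t x \<in> S}"
  have "A \<noteq> {}" using x existence_interval[OF xD] by (force simp: A_def)
  have bdd: "bdd_above A"
  proof (rule bdd_aboveI)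
    show "t \<le> b" if "t \<in> A" for t
      using no \<open>t \<in> A\<close> \<open>\<And>t. b \<le> t \<Longrightarrow> 0 \<le> t \<Longrightarrow> t \<in> ?I \<Longrightarrow> flow D f t x \<in> S \<Longrightarrow> thesis\<close>
      by (cases "b \<le> t") (auto simp: A_def)
  qed
  obtain h where h: "h > 0" "\<And>x. x \<in> S \<Longrightarrow> {-h<..<h} \<subseteq> existence_interval D f x"
    using local_existence_uniform[OF S] by blast
  define T where "T = Sup A"
  have upper: "t \<le> T" if "t \<in> A" for t using cSup_upper[OF that bdd] by (simp add: T_def)
  \<comment> \<open>A visit less than \<open>h\<close> before \<open>T\<close>: restarting from that
    point of \<open>S\<close> gives existence up to and including \<open>T\<close>.\<close>
  obtain t where t: "t \<in> A" "T - h < t"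
    using less_cSupD[OF \<open>A \<noteq> {}\<close>, of "T - h"] h(1) by (auto simp: T_def)
  then have "T - t \<in> existence_interval D f (flow D f t x)"
    using h(1) h(2)[of "flow D f t x"] upper[OF t(1)] by (auto simp: A_def)
  then have TI: "T \<in> ?I" using flow_add(1)[OF xD, of t "T - t"] t(1) by (auto simp: A_def)
  have "T \<ge> 0" using upper[OF t(1)] t(1) by (auto simp: A_def)
  have "flow D f T x \<in> S"
  proof -
    have "T \<in> closure A"
      unfolding T_def using \<open>A \<noteq> {}\<close> bdd by (rule closure_contains_Sup)
    then obtain a where a: "\<And>n. a n \<in> A" "a \<longlonglongrightarrow> T"
      using closure_sequential by metis
    have "(\<lambda>n. flow D f (a n) x) \<longlonglongrightarrow> flow D f T x"
      using flow_continuous_on[OF xD order_refl] a TI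
      unfolding continuous_on_sequentially by (auto simp: o_def A_def)
    moreover have "flow D f (a n) x \<in> S" for n using a(1) by (auto simp: A_def)
    ultimately show ?thesis
      using compact_imp_closed[OF S(1)] closed_sequentially by metis
  qed
  then obtain s where s: "0 < s" "s \<in> existence_interval D f (flow D f T x)"
      "flow D f s (flow D f T x) \<in> S"
    using returns by metis
  then have "T + s \<in> A"
    using flow_add[OF xD TI s(2)] \<open>T \<ge> 0\<close> by (simp add: A_def)
  then show False using upper s(1) by force
qed

text \<open>The orbit may leave \<open>S\<close> between visits, but the existence interval contains
  0 and arbitrarily late visiting times, hence everything in between.\<close>

lemma global_existence:
  assumes x: "x \<in> S"
  shows "{0..} \<subseteq> existence_interval D f x"
proof
  fix b :: real assume "b \<in> {0..}"
  then have "0 \<le> b" by simp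
  obtain t where "b \<le> t" "t \<in> existence_interval D f x"
    using visits_unbounded[OF x, of b] by metis
  then show "b \<in> existence_interval D f x"
    using existence_interval(2,3)[OF S_in_D[OF x]] \<open>0 \<le> b\<close> unfolding is_interval_1 by blast
qed

lemma flow_add_visit:
  assumes "x \<in> S" "0 \<le> t" "flow D f t x \<in> S" "0 \<le> s"
  shows "flow D f (t + s) x = flow D f s (flow D f t x)"
  using flow_add(2)[OF S_in_D[OF assms(1)], of t s] global_existence[OF assms(1)]
    global_existence[OF assms(3)] assms(2,4) by auto

section \<open>The reachable tube of the ball and the constants attached to it\<close>

definition "tube = reachable_tube D f \<tau> (norm_ball N xs \<epsilon>)"

definition "L = one_sided_lipschitz_constant N P f (closure tube)"

definition "F = (SUP x\<in>norm_ball N xs \<epsilon>. N (f x))"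

lemma flow_in_tube:
  assumes "x \<in> norm_ball N xs \<epsilon>" "t \<in> {0..\<tau>}"
  shows "flow D f t x \<in> tube"
  using assms global_existence[OF ball_in_S[OF assms(1)]]
  unfolding tube_def reachable_tube_def by fastforce

text \<open>Orbits from the ball exist for all nonnegative times, so the tube is the image of the
  compact set of pairs \<open>{0..\<tau>} \<times> ?B\<close> under the jointly continuous flow. In
  particular it is closed, and its closure remains in \<open>D\<close>.\<close>

lemma compact_tube: "compact tube"
proof -
  let ?B = "norm_ball N xs \<epsilon>"
  have "tube = (\<lambda>(t, x). flow D f t x) ` ({0..\<tau>} \<times> ?B)"
    using global_existence[OF ball_in_S]
    unfolding tube_def reachable_tube_def by (fastforce simp: image_def)
  moreover have "continuous_on ({0..\<tau>} \<times> ?B) (\<lambda>(t, x). flow D f t x)"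
    using \<tau>_pos global_existence[OF ball_in_S]
    by (intro continuous_on_flow) (force intro: S_in_D ball_in_S)+
  ultimately show ?thesis
    using compact_norm_ball[OF N] by (auto intro!: compact_continuous_image compact_Times)
qed

lemma tube_in_D: "tube \<subseteq> D"
  unfolding tube_def reachable_tube_def
  using flow_in_domain[OF S_in_D[OF ball_in_S]] by blast

lemma ball_in_tube: "norm_ball N xs \<epsilon> \<subseteq> tube"
proof
  fix x assume x: "x \<in> norm_ball N xs \<epsilon>"
  then show "x \<in> tube"
    using flow_in_tube[OF x, of 0] existence_interval(4)[OF S_in_D[OF ball_in_S[OF x]]] \<tau>_pos by simp
qed

lemma one_sided_lipschitz_tube:
  assumes "x \<in> tube" "y \<in> tube"
  shows "P (f y - f x) (y - x) \<le> L * (N (y - x))\<^sup>2"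
proof -
  have cl: "closure tube = tube"
    using compact_tube compact_imp_closed closure_closed by blast
  obtain v :: "real ^ 'd" where "v \<noteq> 0" using nonzero_Basis nonempty_Basis by blast
  then have v: "N v > 0" using N by (auto simp: vector_norm_def less_le)
  \<comment> \<open>A point at \<open>N\<close>-distance exactly \<epsilon> from \<open>xs\<close>;
    together with \<open>xs\<close> it is the pair of distinct points that makes the constant
    \<open>L\<close> meaningful.\<close>
  define p where "p = xs + (\<epsilon> / N v) *\<^sub>R v"
  have "N (p - xs) = \<bar>\<epsilon> / N v\<bar> * N v"
    using N unfolding vector_norm_def p_def by (metis add_diff_cancel_left')
  then have "p \<in> norm_ball N xs \<epsilon>" using v \<epsilon>_pos by (simp add: norm_ball_def)
  moreover have "p \<noteq> xs" using \<open>v \<noteq> 0\<close> v \<epsilon>_pos by (simp add: p_def)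
  ultimately show ?thesis
    unfolding L_def cl
    using one_sided_lipschitz_constant_bound[OF N assoc loc_lip compact_tube tube_in_D _ _ _ assms, of p xs]
      center_in_ball ball_in_tube by blast
qed

text \<open>The supremum is finite because \<open>f\<close> is continuous on the compact
  ball.\<close>

lemma F_bound:
  assumes "x \<in> norm_ball N xs \<epsilon>"
  shows "N (f x) \<le> F"
proof -
  let ?B = "norm_ball N xs \<epsilon>"
  have "?B \<subseteq> D" using S_in_D ball_in_S by blast
  then obtain M where "M-lipschitz_on ?B f"
    using lipschitz_compact compact_norm_ball[OF N] by blast
  then have "compact ((\<lambda>x. N (f x)) ` ?B)"
    by (intro compact_continuous_image continuous_intros N compact_norm_ball lipschitz_on_continuous_on)
  then have "bdd_above ((\<lambda>x. N (f x)) ` ?B)"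
    by (intro bounded_imp_bdd_above compact_imp_bounded)
  then show ?thesis unfolding F_def using assms by (intro cSUP_upper)
qed

lemma F_nonneg: "0 \<le> F"
  using F_bound[OF center_in_ball] N_nonneg[of "f xs"] by simp

section \<open>Trapping near the equilibrium and attraction to the ball\<close>

text \<open>The excursion is measured from the last time before \<open>t\<close> at which the orbit
  is in the ball, so it has lasted at most \<tau>. Its distance from the exit point is bounded by
  the displacement estimate, and the exit point is at distance \<epsilon> from
  \<open>xs\<close>.\<close>

lemma trapped:
  assumes x: "x \<in> norm_ball N xs \<epsilon>" and "0 \<le> t"
  shows "N (flow D f t x - xs) \<le> \<epsilon> + F * growth_factor \<tau> L"
proof (cases "N (flow D f t x - xs) \<le> \<epsilon>")
  case True
  then show ?thesis
    using F_nonneg growth_factor_nonneg[of \<tau> L] \<tau>_pos by (simp add: add_increasing2)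
next
  case False
  have xS: "x \<in> S" and xD: "x \<in> D" using x ball_in_S S_in_D by auto
  define V where "V s = N (flow D f s x - xs)" for s
  have V_cont: "continuous_on {0..t} V"
    unfolding V_def using global_existence[OF xS]
    by (intro continuous_intros N flow_continuous_on xD) auto
  have V0: "V 0 \<le> \<epsilon>"
    using x existence_interval(4)[OF xD] by (simp add: V_def norm_ball_def)
  have "closed ({0..t} \<inter> V -` {..\<epsilon>})"
    by (intro continuous_closed_preimage V_cont) auto
  then have "compact ({0..t} \<inter> V -` {..\<epsilon>})"
    by (metis Int_lower1 bounded_closed_interval bounded_subset compact_eq_bounded_closed)
  moreover have "0 \<in> {0..t} \<inter> V -` {..\<epsilon>}" using V0 \<open>0 \<le> t\<close> by simp
  ultimately obtain t0 where "t0 \<in> {0..t} \<inter> V -` {..\<epsilon>}" "\<forall>s\<in>{0..t} \<inter> V -` {..\<epsilon>}. s \<le> t0"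
    using compact_attains_sup by (metis empty_iff)
  then have t0: "0 \<le> t0" "t0 \<le> t" "V t0 \<le> \<epsilon>"
    and last: "\<And>s. 0 \<le> s \<Longrightarrow> s \<le> t \<Longrightarrow> V s \<le> \<epsilon> \<Longrightarrow> s \<le> t0"
    by auto
  obtain t1 where t1: "t0 \<le> t1" "t1 \<le> t" "V t1 = \<epsilon>"
    using IVT'[of V t0 \<epsilon> t] t0 False continuous_on_subset[OF V_cont, of "{t0..t}"]
    by (auto simp: V_def)
  then have eq: "V t0 = \<epsilon>" using last[of t1] t0 by auto
  define y where "y = flow D f t0 x"
  have y: "y \<in> norm_ball N xs \<epsilon>" and Vy: "N (y - xs) = \<epsilon>"
    using eq by (auto simp: y_def V_def norm_ball_def)
  have yS: "y \<in> S" using ball_in_S[OF y] .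
  obtain s where s: "0 < s" "s \<le> \<tau>" "N (flow D f s y - xs) < \<epsilon>"
    using recurrence[OF yS] Vy by (metis order_refl)
  have add: "flow D f (t0 + r) x = flow D f r y" if "0 \<le> r" for r
    using flow_add_visit[OF xS t0(1) _ that] yS by (simp add: y_def)
  have "V (t0 + s) < \<epsilon>" using s add[of s] by (simp add: V_def)
  \<comment> \<open>The orbit is back in the ball at \<open>t0 + s\<close>; since \<open>t0\<close>
    is the last such time up to \<open>t\<close>, this return comes after \<open>t\<close>.\<close>
  then have "t < t0 + s" using last[of "t0 + s"] s(1) t0(1) by force
  define r where "r = t - t0"
  have r: "0 \<le> r" "r \<le> \<tau>" using t0 \<open>t < t0 + s\<close> s by (auto simp: r_def)
  have "N (flow D f r y - y) \<le> N (f y) * growth_factor r L"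
  proof (rule flow_displacement[OF N assoc S_in_D[OF yS] r(1)])
    show "{0..r} \<subseteq> existence_interval D f y" using global_existence[OF yS] by auto
    show "flow D f t y \<in> tube" if "t \<in> {0..r}" for t
      using flow_in_tube[OF y, of t] that r by auto
  qed (rule one_sided_lipschitz_tube)
  also have "\<dots> \<le> F * growth_factor \<tau> L"
    using F_bound[OF y] F_nonneg r by (intro mult_mono growth_factor_mono growth_factor_nonneg)
  finally have "N (flow D f r y - y) \<le> F * growth_factor \<tau> L" .
  moreover have "N (flow D f r y - xs) \<le> N (flow D f r y - y) + N (y - xs)"
    by (rule N_triangle)
  ultimately show ?thesis using Vy add[OF r(1)] by (simp add: r_def)
qed

text \<open>The \<open>\<omega>\<close>-limit set is taken along all times, not only visits to \<open>S\<close>: a return to the boundary of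
  \<open>S\<close> need not persist for nearby initial points.\<close>

lemma reaches_ball:
  assumes x: "x \<in> S"
  obtains t where "0 \<le> t" "flow D f t x \<in> norm_ball N xs \<epsilon>"
proof (rule ccontr)
  assume "\<not> thesis"
  then have avoid: "N (flow D f t x - xs) > \<epsilon>" if "0 \<le> t" for t
    using that \<open>\<And>t. 0 \<le> t \<Longrightarrow> flow D f t x \<in> norm_ball N xs \<epsilon> \<Longrightarrow> thesis\<close>
    by (force simp: norm_ball_def)
  have xD: "x \<in> D" using S_in_D[OF x] .
  define \<Omega> where "\<Omega> = (\<Inter>n::nat. closure ((\<lambda>t. flow D f t x) ` {real n..}))"
  \<comment> \<open>Visits to the compact set \<open>S\<close> at times tending to infinity have an
    accumulation point, which lies in both sets.\<close>
  have "S \<inter> \<Omega> \<noteq> {}"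
  proof -
    have "\<exists>t. real n \<le> t \<and> flow D f t x \<in> S" for n
      using visits_unbounded[OF x, of "real n"] by metis
    then obtain a where a: "\<And>n. real n \<le> a n" "\<And>n. flow D f (a n) x \<in> S" by metis
    obtain p k where p: "p \<in> S" and k: "strict_mono k"
        and lim: "((\<lambda>n. flow D f (a n) x) \<circ> k) \<longlonglongrightarrow> p"
      using S(1) a(2) unfolding compact_def by metis
    have "p \<in> closure ((\<lambda>t. flow D f t x) ` {real n..})" for n
    proof (rule Lim_in_closed_set[OF closed_closure _ _ lim])
      show "\<forall>\<^sub>F m in sequentially. ((\<lambda>n. flow D f (a n) x) \<circ> k) m \<in>
          closure ((\<lambda>t. flow D f t x) ` {real n..})"
        using eventually_ge_at_top[of n]
      proof eventually_elim
        case (elim m)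
        then have "real n \<le> a (k m)"
          using seq_suble[OF k, of m] a(1)[of "k m"] by linarith
        then show ?case using closure_subset by fastforce
      qed
    qed simp
    then show ?thesis using p by (auto simp: \<Omega>_def)
  qed
  moreover have "compact (S \<inter> \<Omega>)"
    unfolding \<Omega>_def by (intro compact_Int_closed S closed_INT) auto
  moreover have "continuous_on (S \<inter> \<Omega>) (\<lambda>y. N (y - xs))"
    by (intro continuous_intros N)
  ultimately obtain p where p: "p \<in> S" "p \<in> \<Omega>"
      and min: "\<And>y. y \<in> S \<Longrightarrow> y \<in> \<Omega> \<Longrightarrow> N (p - xs) \<le> N (y - xs)"
    using continuous_attains_inf[of "S \<inter> \<Omega>" "\<lambda>y. N (y - xs)"] by blast
  \<comment> \<open>The strict bound along the orbit becomes a weak one in the limit, so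
    \<open>p\<close> may lie on the sphere; \<open>recurrence\<close> covers that case.\<close>
  have far: "\<epsilon> \<le> N (p - xs)"
  proof -
    have "p \<in> closure ((\<lambda>t. flow D f t x) ` {0..})"
      using p(2) unfolding \<Omega>_def by (metis INT_E UNIV_I of_nat_0)
    moreover have "closed {y. \<epsilon> \<le> N (y - xs)}"
      by (intro closed_Collect_le continuous_intros N)
    moreover have "(\<lambda>t. flow D f t x) ` {0..} \<subseteq> {y. \<epsilon> \<le> N (y - xs)}"
      using avoid by (auto intro: less_imp_le)
    ultimately show ?thesis using closure_minimal by blast
  qed
  obtain s where s: "0 < s" "s \<in> existence_interval D f p" "flow D f s p \<in> S"
      "N (flow D f s p - xs) < N (p - xs)"
    using recurrence[OF p(1) far] by metis
  \<comment> \<open>Forward invariance of the \<omega>-limit set: orbit points \<open>y m\<close>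
    tending to \<open>p\<close> are carried to later orbit points, which tend to
    \<open>flow D f s p\<close>.\<close>
  have "flow D f s p \<in> closure ((\<lambda>t. flow D f t x) ` {real n..})" for n
  proof -
    have "p \<in> closure ((\<lambda>t. flow D f t x) ` {real n..})"
      using p(2) unfolding \<Omega>_def by (rule INT_D) simp
    then obtain y where y: "\<And>m. y m \<in> (\<lambda>t. flow D f t x) ` {real n..}" "y \<longlonglongrightarrow> p"
      unfolding closure_sequential by metis
    \<comment> \<open>Joint continuity requires solutions that exist on all of
      \<open>{0..s}\<close>. This is known for \<open>p\<close>, which is in \<open>S\<close>, and
      for points of the orbit, so continuity is used on this set instead of a neighbourhood of
      \<open>p\<close>.\<close>
    define A where "A = insert p ((\<lambda>t. flow D f t x) ` {0..})"
    have glob: "{0..} \<subseteq> existence_interval D f z" "z \<in> D" if "z \<in> A" for z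
      using that existence_interval_atLeast_flow[OF xD global_existence[OF x]]
        global_existence[OF p(1)] S_in_D[OF p(1)] flow_in_domain[OF xD] global_existence[OF x]
      by (auto simp: A_def)
    have "continuous_on ({0..s} \<times> A) (\<lambda>(t, x). flow D f t x)"
      using glob s(1) by (intro continuous_on_flow) force+
    then have "continuous_on A (\<lambda>z. (\<lambda>(t, x). flow D f t x) (s, z))"
      by (rule continuous_on_compose2) (use s(1) in \<open>auto intro!: continuous_intros\<close>)
    moreover have yA: "y m \<in> A" for m
      using y(1)[of m] by (force simp: A_def)
    moreover have "p \<in> A" by (simp add: A_def)
    ultimately have "(\<lambda>m. flow D f s (y m)) \<longlonglongrightarrow> flow D f s p"
      using y(2) unfolding continuous_on_sequentially by (auto simp: o_def)
    moreover have "flow D f s (y m) \<in> (\<lambda>t. flow D f t x) ` {real n..}" for m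
    proof -
      obtain t where t: "real n \<le> t" "y m = flow D f t x" using y(1)[of m] by auto
      have "flow D f (t + s) x = flow D f s (y m)"
      proof -
        have "0 \<le> t" using t(1) of_nat_0_le_iff order_trans by blast
        then have "t \<in> existence_interval D f x" "s \<in> existence_interval D f (y m)"
          using s(1) glob(1)[OF yA[of m]] global_existence[OF x] by auto
        then show ?thesis using flow_add(2)[OF xD, of t s] t(2) by simp
      qed
      moreover have "t + s \<in> {real n..}" using t(1) s(1) by simp
      ultimately show ?thesis by (metis imageI)
    qed
    ultimately show ?thesis
      unfolding closure_sequential by (intro exI[of _ "\<lambda>m. flow D f s (y m)"]) simp
  qed
  then have "flow D f s p \<in> \<Omega>" unfolding \<Omega>_def by (rule INT_I)
  then show False using min[OF s(3)] s(4) by force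
qed

text \<open>The choice \<delta> = \<epsilon> works, since \<open>trapped\<close> applies to the
  whole ball. For a start in \<open>S\<close>, the bound holds at every time after the orbit has
  reached the ball, hence also for the upper limit.\<close>

lemma practically_stable:
  "practically_asymptotically_stable N D f xs S (\<epsilon> + F * growth_factor \<tau> L)"
  unfolding practically_asymptotically_stable_def
proof (intro conjI exI[of _ \<epsilon>] allI ballI impI)
  show "0 < \<epsilon> + F * growth_factor \<tau> L"
    using \<epsilon>_pos F_nonneg growth_factor_nonneg[of \<tau> L] \<tau>_pos by (simp add: add_pos_nonneg)
  show "0 < \<epsilon>" by (rule \<epsilon>_pos)
next
  fix x assume "N (x - xs) \<le> \<epsilon>"
  then have x: "x \<in> norm_ball N xs \<epsilon>" by (simp add: norm_ball_def)
  show "{0..} \<subseteq> existence_interval D f x" using global_existence[OF ball_in_S[OF x]] .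
  fix t :: real assume "0 \<le> t"
  then show "N (flow D f t x - xs) \<le> \<epsilon> + F * growth_factor \<tau> L" using trapped[OF x] by blast
next
  fix x assume x: "x \<in> S"
  show "{0..} \<subseteq> existence_interval D f x" using global_existence[OF x] .
  obtain t0 where t0: "0 \<le> t0" "flow D f t0 x \<in> norm_ball N xs \<epsilon>"
    using reaches_ball[OF x] .
  show "Limsup at_top (\<lambda>t. ereal (N (flow D f t x - xs))) \<le> ereal (\<epsilon> + F * growth_factor \<tau> L)"
  proof (rule Limsup_bounded)
    show "\<forall>\<^sub>F t in at_top. ereal (N (flow D f t x - xs)) \<le> ereal (\<epsilon> + F * growth_factor \<tau> L)"
      using eventually_ge_at_top[of t0]
    proof eventually_elim
      case (elim t)
      then have "flow D f t x = flow D f (t - t0) (flow D f t0 x)"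
        using flow_add_visit[OF x t0(1) ball_in_S[OF t0(2)], of "t - t0"] by simp
      then show ?case using trapped[OF t0(2), of "t - t0"] elim by simp
    qed
  qed
qed

end

theorem theorem6:
  fixes N :: "real ^ 'd \<Rightarrow> real"
    and P :: "real ^ 'd \<Rightarrow> real ^ 'd \<Rightarrow> real"
    and D S :: "(real ^ 'd) set"
    and f :: "real ^ 'd \<Rightarrow> real ^ 'd"
    and xs :: "real ^ 'd"
    and \<epsilon> \<tau> :: real
  assumes "vector_norm N"
    and "associated_weak_pairing N P"
    and "open D"
    and "locally_lipschitz N D f"
    and "xs \<in> D" and "f xs = 0"
    and "\<epsilon> > 0"
    and "compact S" and "S \<subseteq> D"
    and "norm_ball N xs \<epsilon> \<subseteq> interior S"
    and "\<tau> > 0"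
    and "eps_SRLF N D f xs \<epsilon> S \<tau> (\<lambda>x. N (x - xs))"
  shows "practically_asymptotically_stable N D f xs S
           (\<epsilon> + (SUP x\<in>norm_ball N xs \<epsilon>. N (f x)) *
              growth_factor \<tau>
                (one_sided_lipschitz_constant N P f
                   (closure (reachable_tube D f \<tau> (norm_ball N xs \<epsilon>)))))"
proof -
  interpret norm_SRLF N P D S f xs \<epsilon> \<tau>
    using assms by unfold_locales
  show ?thesis
    using practically_stable unfolding F_def L_def tube_def .
qed

end
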